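(* Assume that the drift coefficients $B_1,B_2,B_3,B_4$ are globally Lipschitz, i.e. there is $C>0$ with $|B_j(x)-B_j(y)|\le C|x-y|$ for all $x,y$, that each $B_j\in C^4_{\uparrow}$, and that $\sup_t\mathbf E[|\xi_t|^\ell]<\infty$, $\sup_t\mathbf E[|\delta_t|^\ell]<\infty$, $\sup_t\mathbf E[|\varepsilon_t|^\ell]<\infty$, $\sup_t\mathbf E[|\zeta_t|^\ell]<\infty$ for all $\ell\ge 0$. Assume also that for every $m\in\{1,\dots,M\}$, $\mathrm H_m(\theta_m)=\mathrm H_m(\bar\theta_m)$ with $\theta_m\in\Theta_m$ implies $\theta_m=\bar\theta_m$. Suppose that some but not all of the competing models are misspecified, i.e. $\mathcal M$ and $\mathcal M^c$ are both non-empty. Then, as $n\to\infty$, $$\mathbf P\bigl(\hat m_n\in\mathcal M^c\bigr)\longrightarrow0.$$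
   Context: True model. Let $p_1,p_2,k_1,k_2,r_1,\dots,r_4$ be fixed positive integers with $k_1\le p_1$, $k_2\le p_2$, and $p=p_1+p_2$. On a stochastic basis $(\Omega,\mathscr F,\{\mathscr F_t\},\mathbf P)$ satisfying the usual conditions, $W_1,\dots,W_4$ are independent standard Wiener processes of dimensions $r_1,\dots,r_4$; $\mathbf E$ is expectation under $\mathbf P$. For constant matrices $\mathbf S_{j,0}$ and constant vectors $c_j$ of matching dimensions, $d\xi_t=B_1(\xi_t)dt+\mathbf S_{1,0}dW_{1,t}$, $\xi_0=c_1$ (in $\mathbb R^{k_1}$); $d\delta_t=B_2(\delta_t)dt+\mathbf S_{2,0}dW_{2,t}$, $\delta_0=c_2$ (in $\mathbb R^{p_1}$); $d\varepsilon_t=B_3(\varepsilon_t)dt+\mathbf S_{3,0}dW_{3,t}$, $\varepsilon_0=c_3$ (in $\mathbb R^{p_2}$); $d\zeta_t=B_4(\zeta_t)dt+\mathbf S_{4,0}dW_{4,t}$, $\zeta_0=c_4$ (in $\mathbb R^{k_2}$), $t\ge 0$. The observable process is $\mathbb X_t=(\mathbb X_{1,t}^\top,\mathbb X_{2,t}^\top)^\top\in\mathbb R^p$ with $\mathbb X_{1,t}=\mathbf\Lambda_{x_1,0}\xi_t+\delta_t$, $\mathbb X_{2,t}=\mathbf\Lambda_{x_2,0}\eta_t+\varepsilon_t$, $\eta_t=\mathbf B_0\eta_t+\mathbf\Gamma_0\xi_t+\zeta_t$, where $\mathbf\Lambda_{x_1,0}\in\mathbb R^{p_1\times k_1}$ has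 full column rank, $\mathbf\Lambda_{x_2,0}\in\mathbb R^{p_2\times k_2}$, $\mathbf\Gamma_0\in\mathbb R^{k_2\times k_1}$, $\mathbf B_0\in\mathbb R^{k_2\times k_2}$ has zero diagonal and $\mathbf\Psi_0=\mathbb I_{k_2}-\mathbf B_0$ is non-singular. Put $\mathbf\Sigma_{\xi\xi,0}=\mathbf S_{1,0}\mathbf S_{1,0}^\top$, $\mathbf\Sigma_{\delta\delta,0}=\mathbf S_{2,0}\mathbf S_{2,0}^\top$, $\mathbf\Sigma_{\varepsilon\varepsilon,0}=\mathbf S_{3,0}\mathbf S_{3,0}^\top$, $\mathbf\Sigma_{\zeta\zeta,0}=\mathbf S_{4,0}\mathbf S_{4,0}^\top$; $\mathbf\Sigma_{\delta\delta,0}$ and $\mathbf\Sigma_{\varepsilon\varepsilon,0}$ are positive definite. $\mathbf\Sigma_0$ is the symmetric $p\times p$ block matrix with blocks $\mathbf\Sigma_0^{11}=\mathbf\Lambda_{x_1,0}\mathbf\Sigma_{\xi\xi,0}\mathbf\Lambda_{x_1,0}^\top+\mathbf\Sigma_{\delta\delta,0}$, $\mathbf\Sigma_0^{12}=\mathbf\Lambda_{x_1,0}\mathbf\Sigma_{\xi\xi,0}\mathbf\Gamma_0^\top\mathbf\Psi_0^{-1\top}\mathbf\Lambda_{x_2,0}^\top$, $\mathbf\Sigma_0^{22}=\mathbf\Lambda_{x_2,0}\mathbf\Psi_0^{-1}(\mathbf\Gamma_0\mathbf\Sigma_{\xi\xi,0}\mathbf\Gamma_0^\top+\mathbf\Sigma_{\zeta\zeta,0})\mathbf\Psi_0^{-1\top}\mathbf\Lambda_{x_2,0}^\top+\mathbf\Sigma_{\varepsilon\varepsilon,0}$.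 Observations. $T>0$ is fixed, $h_n=T/n$, $t_i^n=ih_n$, $\mathbb X_n=(\mathbb X_{t_i^n})_{0\le i\le n}$, $\Delta_i\mathbb X=\mathbb X_{t_i^n}-\mathbb X_{t_{i-1}^n}$. Competing models. For each $m\in\{1,\dots,M\}$, $\Theta_m\subset\mathbb R^{q_m}$ is convex, compact, with locally Lipschitz boundary. For $\theta=\theta_m\in\Theta_m$ there are matrices $\mathbf\Lambda^\theta_{x_1,m}$ (full column rank), $\mathbf\Lambda^\theta_{x_2,m}$, $\mathbf\Gamma^\theta_m$, $\mathbf B^\theta_m$ (zero diagonal, $\mathbf\Psi^\theta_m=\mathbb I_{k_2}-\mathbf B^\theta_m$ non-singular), $\mathbf S^\theta_{1,m},\dots,\mathbf S^\theta_{4,m}$ of the same sizes as in the true model; $\mathbf\Sigma^\theta_{\xi\xi,m},\mathbf\Sigma^\theta_{\delta\delta,m},\mathbf\Sigma^\theta_{\varepsilon\varepsilon,m},\mathbf\Sigma^\theta_{\zeta\zeta,m}$ are $\mathbf S^\theta_{j,m}\mathbf S^{\theta\top}_{j,m}$, $j=1,2,3,4$ respectively, with $\mathbf\Sigma^\theta_{\delta\delta,m},\mathbf\Sigma^\theta_{\varepsilon\varepsilon,m}$ positive definite. $\mathbf\Sigma_m(\theta_m)$ is defined by the same block formula as $\mathbf\Sigma_0$ with these matrices, and $\theta_m\mapsto\mathbf\Sigma_m(\theta_m)$ is continuous on $\Theta_m$. Models may be misspecified: $$\mathcal M=\bigl\{m\in\{1,\dots,M\}:\ \text{there exists }\theta_{m,0}\in\Theta_m\text{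 with }\mathbf\Sigma_0=\mathbf\Sigma_m(\theta_{m,0})\bigr\},\qquad \mathcal M^c=\{1,\dots,M\}\setminus\mathcal M.$$ Quasi-likelihood, estimator, criterion. For matrices $A,B$ of the same size $A[B]=\operatorname{tr}(AB^\top)$; $x^{\otimes2}=xx^\top$; $$\mathrm L_{m,n}(\mathbb X_n,\theta_m)=\prod_{i=1}^n\frac{1}{(2\pi h_n)^{p/2}(\det\mathbf\Sigma_m(\theta_m))^{1/2}}\exp\Bigl(-\frac1{2h_n}\mathbf\Sigma_m(\theta_m)^{-1}\bigl[(\Delta_i\mathbb X)^{\otimes2}\bigr]\Bigr),$$ $\hat\theta_{m,n}=\hat\theta_{m,n}(\mathbb X_n)$ is a (measurable) maximizer of $\theta_m\mapsto\mathrm L_{m,n}(\mathbb X_n,\theta_m)$ over $\Theta_m$, $$\mathrm{QAIC}(\mathbb X_n,m)=-2\log\mathrm L_{m,n}(\mathbb X_n,\hat\theta_{m,n})+2q_m,$$ and $\hat m_n\in\{1,\dots,M\}$ is a (measurable) minimizer: $\mathrm{QAIC}(\mathbb X_n,\hat m_n)=\min_{m}\mathrm{QAIC}(\mathbb X_n,m)$. Further notation. $\mathrm H_m(\theta_m)=-\frac12\operatorname{tr}(\mathbf\Sigma_m(\theta_m)^{-1}\mathbf\Sigma_0)-\frac12\log\det\mathbf\Sigma_m(\theta_m)$, and $\bar\theta_m\in\Theta_m$ satisfies $\mathrm H_m(\bar\theta_m)=\sup_{\theta_m\in\Theta_m}\mathrm H_m(\theta_m)$. $C^k_\uparrow(\mathbb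 R^d)$ is the set of functions on $\mathbb R^d$ that are $k$ times continuously differentiable and that, together with all these derivatives, have polynomial growth, i.e. are bounded in norm by $C(1+|x|)^C$ for some $C>0$. *)

theory Defs
  imports "HOL-Probability.Probability"
begin

section \<open>Matrices\<close>

definition block_vec :: "real^'a \<Rightarrow> real^'b \<Rightarrow> real^('a + 'b)" where
  "block_vec u v = (\<chi> i. case i of Inl a \<Rightarrow> u $ a | Inr b \<Rightarrow> v $ b)"

definition block_mat ::
  "real^'a^'a \<Rightarrow> real^'b^'a \<Rightarrow> real^'a^'b \<Rightarrow> real^'b^'b \<Rightarrow> real^('a + 'b)^('a + 'b)" where
  "block_mat A11 A12 A21 A22 = (\<chi> i j.
     case i of
       Inl a \<Rightarrow> (case j of Inl a' \<Rightarrow> A11 $ a $ a' | Inr b' \<Rightarrow> A12 $ a $ b')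
     | Inr b \<Rightarrow> (case j of Inl a' \<Rightarrow> A21 $ b $ a' | Inr b' \<Rightarrow> A22 $ b $ b'))"

definition pos_def_mat :: "real^'n^'n \<Rightarrow> bool" where
  "pos_def_mat A \<longleftrightarrow> transpose A = A \<and> (\<forall>x. x \<noteq> 0 \<longrightarrow> x \<bullet> (A *v x) > 0)"

definition mat_bracket :: "real^'n^'m \<Rightarrow> real^'n^'m \<Rightarrow> real" where
  "mat_bracket A B = trace (A ** transpose B)"

definition outer_square :: "real^'n \<Rightarrow> real^'n^'n" where
  "outer_square x = (\<chi> i j. x $ i * x $ j)"

section \<open>Parameters of the structural equation model\<close>

record ('p1, 'p2, 'k1, 'k2, 'r1, 'r2, 'r3, 'r4) sem_params =
  Lam1 :: "real^'k1^'p1"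
  Lam2 :: "real^'k2^'p2"
  Gam :: "real^'k1^'k2"
  Bmat :: "real^'k2^'k2"
  S1 :: "real^'r1^'k1"
  S2 :: "real^'r2^'p1"
  S3 :: "real^'r3^'p2"
  S4 :: "real^'r4^'k2"

definition Psi ::
  "('p1::finite, 'p2::finite, 'k1::finite, 'k2::finite, 'r1::finite, 'r2::finite, 'r3::finite, 'r4::finite) sem_params
    \<Rightarrow> real^'k2^'k2" where
  "Psi a = mat 1 - Bmat a"

definition admissible ::
  "('p1::finite, 'p2::finite, 'k1::finite, 'k2::finite, 'r1::finite, 'r2::finite, 'r3::finite, 'r4::finite) sem_params
    \<Rightarrow> bool" where
  "admissible a \<longleftrightarrow>
     rank (Lam1 a) = CARD('k1) \<and>
     (\<forall>i. Bmat a $ i $ i = 0) \<and> invertible (Psi a) \<and>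
     pos_def_mat (S2 a ** transpose (S2 a)) \<and> pos_def_mat (S3 a ** transpose (S3 a))"

definition Sigma_mat ::
  "('p1::finite, 'p2::finite, 'k1::finite, 'k2::finite, 'r1::finite, 'r2::finite, 'r3::finite, 'r4::finite) sem_params
    \<Rightarrow> real^('p1 + 'p2)^('p1 + 'p2)" where
  "Sigma_mat a =
    (let Sxx = S1 a ** transpose (S1 a);
         Sdd = S2 a ** transpose (S2 a);
         See = S3 a ** transpose (S3 a);
         Szz = S4 a ** transpose (S4 a);
         Pinv = matrix_inv (Psi a);
         Sig11 = Lam1 a ** Sxx ** transpose (Lam1 a) + Sdd;
         Sig12 = Lam1 a ** Sxx ** transpose (Gam a) ** transpose Pinv ** transpose (Lam2 a);
         Sig22 = Lam2 a ** Pinv ** (Gam a ** Sxx ** transpose (Gam a) + Szz)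
                   ** transpose Pinv ** transpose (Lam2 a) + See
     in block_mat Sig11 Sig12 (transpose Sig12) Sig22)"

section \<open>Stochastic basis, Wiener processes, stochastic differential equations\<close>

text \<open>Filtrations and processes are indexed by the reals; only times \<open>t \<ge> 0\<close> are constrained.\<close>

definition usual_stochastic_basis :: "'a measure \<Rightarrow> (real \<Rightarrow> 'a measure) \<Rightarrow> bool" where
  "usual_stochastic_basis P F \<longleftrightarrow>
     prob_space P \<and>
     (\<forall>t\<ge>0. subalgebra P (F t)) \<and>
     (\<forall>s\<ge>0. \<forall>t\<ge>s. sets (F s) \<subseteq> sets (F t)) \<and>
     (\<forall>t\<ge>0. sets (F t) = (\<Inter>s\<in>{t<..}. sets (F s))) \<and>
     (\<forall>N\<in>null_sets P. \<forall>A\<subseteq>N. A \<in> sets (F 0))"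

definition adapted :: "(real \<Rightarrow> 'a measure) \<Rightarrow> (real \<Rightarrow> 'a \<Rightarrow> real^'n) \<Rightarrow> bool" where
  "adapted F Y \<longleftrightarrow> (\<forall>t\<ge>0. Y t \<in> borel_measurable (F t))"

definition wiener_process ::
  "'a measure \<Rightarrow> (real \<Rightarrow> 'a measure) \<Rightarrow> (real \<Rightarrow> 'a \<Rightarrow> real^'n) \<Rightarrow> bool" where
  "wiener_process P F W \<longleftrightarrow>
     adapted F W \<and>
     (AE \<omega> in P. W 0 \<omega> = 0) \<and>
     (AE \<omega> in P. continuous_on {0..} (\<lambda>t. W t \<omega>)) \<and>
     (\<forall>s\<ge>0. \<forall>t>s.
        prob_space.indep_set P (sets (F s))
          (sets (vimage_algebra (space P) (\<lambda>\<omega>. W t \<omega> - W s \<omega>) borel)) \<and>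
        distributed P lborel (\<lambda>\<omega>. W t \<omega> - W s \<omega>)
          (\<lambda>x. ennreal (\<Prod>i\<in>UNIV. normal_density 0 (sqrt (t - s)) (x $ i))))"

definition history :: "'a measure \<Rightarrow> (real \<Rightarrow> 'a \<Rightarrow> real^'n) \<Rightarrow> 'a set set" where
  "history P W =
     sigma_sets (space P) {W t -` A \<inter> space P | t A. 0 \<le> t \<and> A \<in> sets borel}"

text \<open>
  The equation \<open>dY = B(Y) dt + S dW\<close>, \<open>Y 0 = c\<close>. Since \<open>S\<close> is a constant matrix, the
  stochastic integral of \<open>S\<close> over \<open>[0, t]\<close> is \<open>S (W t - W 0)\<close>.
\<close>

definition sde_solution ::
  "'a measure \<Rightarrow> (real \<Rightarrow> 'a measure) \<Rightarrow> (real^'d \<Rightarrow> real^'d) \<Rightarrow> real^'r^'d \<Rightarrow>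
   (real \<Rightarrow> 'a \<Rightarrow> real^'r) \<Rightarrow> real^'d \<Rightarrow> (real \<Rightarrow> 'a \<Rightarrow> real^'d) \<Rightarrow> bool" where
  "sde_solution P F B S W c Y \<longleftrightarrow>
     adapted F Y \<and>
     (AE \<omega> in P. continuous_on {0..} (\<lambda>t. Y t \<omega>) \<and>
        (\<forall>t\<ge>0. Y t \<omega> = c + integral {0..t} (\<lambda>s. B (Y s \<omega>)) + S *v (W t \<omega> - W 0 \<omega>)))"

definition bounded_moments :: "'a measure \<Rightarrow> (real \<Rightarrow> 'a \<Rightarrow> real^'n) \<Rightarrow> bool" where
  "bounded_moments P Y \<longleftrightarrow>
     (\<forall>l\<ge>0. (SUP t\<in>{0..}. \<integral>\<^sup>+\<omega>. ennreal (norm (Y t \<omega>) powr l) \<partial>P) < \<infinity>)"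

section \<open>Smooth functions of polynomial growth\<close>

definition poly_growth :: "(real^'d \<Rightarrow> real^'e) \<Rightarrow> bool" where
  "poly_growth f \<longleftrightarrow> (\<exists>C>0. \<forall>x. norm (f x) \<le> C * (1 + norm x) powr C)"

text \<open>
  \<open>C_poly k f\<close>: \<open>f\<close> is \<open>k\<close> times continuously differentiable, and \<open>f\<close> and its iterated partial
  derivatives up to order \<open>k\<close> have polynomial growth.
\<close>

primrec C_poly :: "nat \<Rightarrow> (real^'d \<Rightarrow> real^'e) \<Rightarrow> bool" where
  "C_poly 0 f \<longleftrightarrow> continuous_on UNIV f \<and> poly_growth f"
| "C_poly (Suc k) f \<longleftrightarrow>
     continuous_on UNIV f \<and> poly_growth f \<and> (\<forall>x. f differentiable at x) \<and>
     (\<forall>i. C_poly k (\<lambda>x. frechet_derivative f (at x) (axis i 1)))"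

section \<open>Parameter spaces\<close>

text \<open>
  The dimensions of the parameter spaces of the competing models differ. A copy of Euclidean space
  of dimension \<open>card J\<close> inside \<open>real^'q\<close> is given by the vectors supported on \<open>J\<close>.
\<close>

definition coord_space :: "'q set \<Rightarrow> (real^'q) set" where
  "coord_space J = {x. \<forall>i. i \<notin> J \<longrightarrow> x $ i = 0}"

text \<open>
  Each boundary point of \<open>S\<close> (relative to the coordinate space \<open>V\<close>) has a neighbourhood in which
  \<open>S\<close> is the region on one side of the graph of a Lipschitz function, in some Cartesian coordinate
  system of \<open>V\<close>. The unit vector \<open>e\<close> is the last axis of that system, and the hyperplane of \<open>V\<close>
  orthogonal to \<open>e\<close> carries the remaining coordinates.
\<close>

definition locally_lipschitz_boundary :: "(real^'q) set \<Rightarrow> (real^'q) set \<Rightarrow> bool" where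
  "locally_lipschitz_boundary V S \<longleftrightarrow>
     (\<forall>x \<in> (top_of_set V) frontier_of S.
        \<exists>U e L f. open U \<and> x \<in> U \<and> e \<in> V \<and> norm e = 1 \<and>
          L-lipschitz_on {y \<in> V. y \<bullet> e = 0} f \<and>
          S \<inter> U = {y \<in> V \<inter> U. y \<bullet> e \<le> f (y - (y \<bullet> e) *\<^sub>R e)})"

section \<open>Quasi-likelihood and information criterion\<close>

text \<open>Here \<open>x i\<close> is the observation at time \<open>i * T / n\<close>, for \<open>0 \<le> i \<le> n\<close>.\<close>

definition sample_vec ::
  "real \<Rightarrow> (real \<Rightarrow> 'a \<Rightarrow> real^'p) \<Rightarrow> nat \<Rightarrow> 'a \<Rightarrow> (nat \<Rightarrow> real^'p)" where
  "sample_vec T X n \<omega> = (\<lambda>i\<in>{0..n}. X (real i * (T / real n)) \<omega>)"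

definition quasi_lik :: "real \<Rightarrow> nat \<Rightarrow> real^'p^'p \<Rightarrow> (nat \<Rightarrow> real^'p) \<Rightarrow> real" where
  "quasi_lik T n Sig x =
    (let h = T / real n in
     \<Prod>i = 1..n. 1 / ((2 * pi * h) powr (real CARD('p) / 2) * (det Sig) powr (1 / 2)) *
       exp (- (1 / (2 * h)) * mat_bracket (matrix_inv Sig) (outer_square (x i - x (i - 1)))))"

definition QAIC :: "real \<Rightarrow> nat \<Rightarrow> real^'p^'p \<Rightarrow> nat \<Rightarrow> (nat \<Rightarrow> real^'p) \<Rightarrow> real" where
  "QAIC T n Sig_hat q x = - 2 * ln (quasi_lik T n Sig_hat x) + 2 * real q"

definition H_fun :: "real^'p^'p \<Rightarrow> real^'p^'p \<Rightarrow> real" where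
  "H_fun Sig0 Sig = - (1 / 2) * trace (matrix_inv Sig ** Sig0) - (1 / 2) * ln (det Sig)"

end

theory Submission
  imports Defs
begin

text \<open>
  Per observation, the quasi-log-likelihood of a model with covariance \<open>S\<close> is, up to a term common to
  all models, \<open>H_fun V S\<close>, where \<open>V\<close> is the realized covariance matrix of the data. The drifts are
  pathwise Lipschitz, so they do not contribute to the limit of \<open>V\<close>; the remaining products of
  Brownian increments are uncorrelated, so \<open>V\<close> converges in probability to \<open>\<Sigma>0\<close>. As
  \<open>H_fun \<Sigma>0\<close> has its strict maximum at \<open>\<Sigma>0\<close>, compactness of the parameter spaces bounds
  it on the misspecified models away from that maximum. Hence, when \<open>V\<close> is close to
  \<open>\<Sigma>0\<close>, the criterion of a misspecified model exceeds that of a correct one by a multiple of \<open>n\<close>,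
  which beats the bounded penalty.
\<close>

section \<open>Symmetric matrices and the Gaussian entropy function\<close>

text \<open>The estimators are never shown to converge. In a correct model the maximiser does at
  least as well as a parameter with covariance \<Sigma>0, and for the misspecified models the bound
  is uniform over their parameters. What remains is a deterministic statement: if all entries of
  \<open>V\<close> are within some \<open>d\<close> of \<Sigma>0 and \<open>n\<close> is large, no
  misspecified model is selected. Uniformity comes from \<open>H_fun V S\<close> being affine in
  \<open>V\<close> with slope given by the inverse of \<open>S\<close>, and inverses stay bounded
  over a compact set of positive definite matrices.

  The drift is controlled path by path, with a Lipschitz constant that depends on the outcome,
  whereas the noise is controlled in mean square; convergence in probability is the mode in which
  the two can be added. The four noises enter through the rows of a joint loading matrix, whose Gram
  matrix is \<Sigma>0, so the limit of \<open>V\<close> reduces by bilinearity to realized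
  covariations of pairs of scalar Wiener coordinates.\<close>

lemma continuous_on_det [continuous_intros]:
  fixes f :: "'a::topological_space \<Rightarrow> real^'n^'n"
  assumes "continuous_on S f"
  shows "continuous_on S (\<lambda>x. det (f x))"
  unfolding det_def by (intro continuous_intros assms)

lemma
  fixes A :: "real^'n^'n"
  assumes "invertible A"
  shows matrix_inv_mult_right: "A ** matrix_inv A = mat 1"
    and matrix_inv_mult_left: "matrix_inv A ** A = mat 1"
  using someI_ex[of "\<lambda>A'. A ** A' = mat 1 \<and> A' ** A = mat 1"] assms
  unfolding matrix_inv_def invertible_def by auto

lemma matrix_inv_unique:
  fixes A :: "real^'n^'n"
  assumes "B ** A = mat 1"
  shows "matrix_inv A = B"
proof -
  have "invertible A"
    using assms invertible_left_inverse by blast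
  then have "B ** (A ** matrix_inv A) = B" 
    by (simp add: matrix_inv_mult_right)
  then show ?thesis
    using assms by (simp add: matrix_mul_assoc)
qed

text \<open>Cramer's rule, applied to the columns of the inverse. A quotient of determinants is
  visibly continuous in the entries, which is how \<open>continuous_on_matrix_inv\<close>
  follows.\<close>

lemma matrix_inv_component:
  fixes A :: "real^'n^'n"
  assumes "det A \<noteq> 0"
  shows "matrix_inv A $ k $ l = det (\<chi> i j. if j = k then mat 1 $ i $ l else A $ i $ j) / det A"
proof -
  have "A *v column l (matrix_inv A) = column l (A ** matrix_inv A)"
    by (simp add: column_def matrix_vector_mult_def matrix_matrix_mult_def vec_eq_iff)
  also have "\<dots> = column l (mat 1)"
    using assms by (simp add: matrix_inv_mult_right invertible_det_nz)
  finally have "column l (matrix_inv A) =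
      (\<chi> k. det (\<chi> i j. if j = k then column l (mat 1) $ i else A $ i $ j) / det A)"
    using cramer[OF assms] by blast
  then have "column l (matrix_inv A) $ k =
      det (\<chi> i j. if j = k then column l (mat 1) $ i else A $ i $ j) / det A"
    by simp
  then show ?thesis by (simp add: column_def cong: if_cong)
qed

lemma continuous_on_matrix_inv:
  fixes f :: "'a::topological_space \<Rightarrow> real^'n^'n"
  assumes "continuous_on S f" and "\<And>x. x \<in> S \<Longrightarrow> det (f x) \<noteq> 0"
  shows "continuous_on S (\<lambda>x. matrix_inv (f x))"
proof -
  have "continuous_on S (\<lambda>x. if j = k then mat 1 $ i $ l else f x $ i $ j)" for i j k l :: 'n
    by (cases "j = k") (auto intro!: continuous_intros assms)
  then have "continuous_on S (\<lambda>x. \<chi> k l.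
      det (\<chi> i j. if j = k then mat 1 $ i $ l else f x $ i $ j) / det (f x))"
    by (intro continuous_intros assms ballI)
  then show ?thesis
    by (rule continuous_on_eq) (simp add: vec_eq_iff matrix_inv_component assms)
qed

lemma inner_matrix_vector_mult:
  fixes A :: "real^'n^'m"
  shows "x \<bullet> (A *v y) = (transpose A *v x) \<bullet> y"
  by (simp add: dot_lmul_matrix)

section \<open>Diagonal matrices and diagonalisation of symmetric matrices\<close>

definition diag_mat :: "('n \<Rightarrow> real) \<Rightarrow> real^'n^'n" where
  "diag_mat d = (\<chi> i j. if i = j then d i else 0)"

lemma diag_mat_mult: "diag_mat d ** diag_mat e = diag_mat (\<lambda>i. d i * e i)"
proof -
  have "(\<Sum>k\<in>UNIV. (if i = k then d i else 0) * (if k = j then e k else 0)) =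
      (\<Sum>k\<in>UNIV. if k = i then (if i = j then d i * e i else 0) else 0)" for i j
    by (rule sum.cong) auto
  then show ?thesis
    by (simp add: diag_mat_def matrix_matrix_mult_def vec_eq_iff)
qed

lemma transpose_diag_mat: "transpose (diag_mat d) = diag_mat d"
  by (auto simp: diag_mat_def transpose_def vec_eq_iff)

lemma diag_mat_one: "diag_mat (\<lambda>i. 1) = mat 1"
  by (simp add: diag_mat_def mat_def)

lemma det_diag_mat: "det (diag_mat d) = (\<Prod>i\<in>UNIV. d i)"
  by (subst det_diagonal) (auto simp: diag_mat_def)

lemma trace_diag_mat: "trace (diag_mat d) = (\<Sum>i\<in>UNIV. d i)"
  by (simp add: diag_mat_def trace_def)

text \<open>A maximiser of the Rayleigh quotient on the unit sphere of the orthogonal complement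
  \<open>V\<close> of \<open>S\<close> is an eigenvector. Since \<open>S\<close> consists of
  eigenvectors of a symmetric matrix, \<open>V\<close> is invariant under \<open>A\<close>, so the
  maximiser can be varied within \<open>V\<close> in the direction of its own residual. The
  cardinality bound makes \<open>V\<close> nonzero.\<close>

lemma symmetric_matrix_eigenvector_orthogonal:
  fixes A :: "real^'n^'n"
  assumes sym: "transpose A = A" and card: "card S < CARD('n)" and fin: "finite S"
    and eig: "\<And>v. v \<in> S \<Longrightarrow> \<exists>c. A *v v = c *\<^sub>R v"
  obtains v c where "norm v = 1" "A *v v = c *\<^sub>R v" "\<And>s. s \<in> S \<Longrightarrow> orthogonal v s"
proof -
  define V where "V = {x. \<forall>s\<in>S. s \<bullet> x = 0}"
  have V_closed: "closed V"
  proof -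
    have "V = (\<Inter>s\<in>S. {x. s \<bullet> x = 0})" by (auto simp: V_def)
    then show ?thesis by (auto intro!: closed_INT closed_hyperplane)
  qed
  have subV: "subspace V"
    by (auto simp: subspace_def V_def inner_right_distrib)
  have A_V: "A *v x \<in> V" if "x \<in> V" for x
  proof -
    have "s \<bullet> (A *v x) = 0" if s: "s \<in> S" for s
    proof -
      obtain c where "A *v s = c *\<^sub>R s" using eig s by blast
      then have "s \<bullet> (A *v x) = c * (s \<bullet> x)"
        using inner_matrix_vector_mult[of s A x] sym by simp
      then show ?thesis using \<open>x \<in> V\<close> s by (simp add: V_def)
    qed
    then show ?thesis by (simp add: V_def)
  qed
  have sym': "x \<bullet> (A *v y) = y \<bullet> (A *v x)" for x y
    by (metis inner_matrix_vector_mult sym inner_commute)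
  have "dim S < DIM(real^'n)"
    using card dim_le_card'[OF fin] by simp
  then obtain x0 where x0: "x0 \<noteq> 0" "\<And>y. y \<in> span S \<Longrightarrow> orthogonal x0 y"
    using orthogonal_to_subspace_exists by blast
  define K where "K = sphere 0 1 \<inter> V"
  have "x0 /\<^sub>R norm x0 \<in> K"
    using x0 span_base[of _ S] by (auto simp: K_def V_def orthogonal_def inner_commute)
  moreover have "compact K"
    unfolding K_def by (intro compact_Int_closed V_closed compact_sphere)
  moreover have "continuous_on K (\<lambda>x. x \<bullet> (A *v x))"
    by (intro continuous_intros matrix_vector_mult_linear_continuous_on)
  ultimately obtain v where v: "v \<in> K" and max: "\<And>x. x \<in> K \<Longrightarrow> x \<bullet> (A *v x) \<le> v \<bullet> (A *v v)"
    using continuous_attains_sup[of K "\<lambda>x. x \<bullet> (A *v x)"] by blast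
  define c where "c = v \<bullet> (A *v v)"
  have vV: "v \<in> V" and nv: "norm v = 1" using v by (auto simp: K_def)
  have rayleigh: "x \<bullet> (A *v x) \<le> c * (x \<bullet> x)" if "x \<in> V" for x
  proof (cases "x = 0")
    case False
    then have "x /\<^sub>R norm x \<in> K" using that subV by (simp add: K_def subspace_def)
    from max[OF this] have "x \<bullet> (A *v x) / (norm x)\<^sup>2 \<le> c"
      by (simp add: c_def matrix_vector_mult_scaleR power2_eq_square divide_inverse mult_ac)
    then show ?thesis
      using False by (simp add: divide_le_eq power2_norm_eq_inner split: if_splits)
  qed simp
  \<comment> \<open>The residual of the eigenvalue equation; the first-order condition at the
    maximum forces it to vanish.\<close>
  define w where "w = A *v v - c *\<^sub>R v"
  have wV: "w \<in> V" using A_V vV subV by (simp add: w_def subspace_def subspace_diff)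
  define K2 where "K2 = c * (w \<bullet> w) - w \<bullet> (A *v w)"
  have K2: "K2 \<ge> 0" using rayleigh[OF wV] by (simp add: K2_def)
  \<comment> \<open>This is \<open>rayleigh\<close> at \<open>v + t *\<^sub>R w\<close>: the terms
    without \<open>t\<close> agree on both sides, and the coefficient of \<open>2 * t\<close> is
    \<open>w \<bullet> w\<close>.\<close>
  have quad: "2 * t * (w \<bullet> w) \<le> t\<^sup>2 * K2" for t
  proof -
    have "v + t *\<^sub>R w \<in> V" using vV wV subV by (simp add: subspace_def)
    from rayleigh[OF this]
    have "(v + t *\<^sub>R w) \<bullet> (A *v (v + t *\<^sub>R w)) \<le> c * ((v + t *\<^sub>R w) \<bullet> (v + t *\<^sub>R w))" .
    also have "(v + t *\<^sub>R w) \<bullet> (A *v (v + t *\<^sub>R w)) = c + 2 * t * (w \<bullet> (A *v v)) + t\<^sup>2 * (w \<bullet> (A *v w))"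
      using sym'[of v w]
      by (simp add: c_def matrix_vector_right_distrib matrix_vector_mult_scaleR inner_add_left
        inner_add_right power2_eq_square algebra_simps)
    also have "(v + t *\<^sub>R w) \<bullet> (v + t *\<^sub>R w) = 1 + 2 * t * (w \<bullet> v) + t\<^sup>2 * (w \<bullet> w)"
      using nv by (simp add: inner_add_left inner_add_right power2_eq_square inner_commute norm_eq_1)
    finally have "2 * t * (w \<bullet> (A *v v) - c * (w \<bullet> v)) \<le> t\<^sup>2 * K2"
      by (simp add: K2_def algebra_simps)
    moreover have "w \<bullet> w = w \<bullet> (A *v v) - c * (w \<bullet> v)"
      unfolding w_def by (simp add: inner_diff_right)
    ultimately show ?thesis by simp
  qed
  have "w \<bullet> w = 0"
  proof (rule ccontr)
    assume "w \<bullet> w \<noteq> 0"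
    then have pos: "w \<bullet> w > 0" by simp
    \<comment> \<open>For this \<open>t\<close>, \<open>quad\<close> gives
      \<open>2 * (w \<bullet> w) \<le> t * K2\<close>, while \<open>t * K2\<close> is at most
      \<open>w \<bullet> w\<close>. The added 1 covers the case \<open>K2 = 0\<close>.\<close>
    define t where "t = (w \<bullet> w) / (K2 + 1)"
    have t: "t > 0" using pos K2 by (simp add: t_def)
    have "2 * (w \<bullet> w) \<le> t * K2"
      using quad[of t] t by (simp add: power2_eq_square mult_ac)
    also have "\<dots> \<le> w \<bullet> w"
      using K2 pos by (simp add: t_def divide_simps)
    finally show False using pos by simp
  qed
  then have "A *v v = c *\<^sub>R v" by (simp add: w_def)
  moreover have "orthogonal v s" if "s \<in> S" for s
    using vV that by (simp add: V_def orthogonal_def inner_commute)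
  ultimately show ?thesis using that nv by blast
qed

text \<open>Orthonormal eigenvectors are collected one at a time; the preceding lemma supplies
  another as long as fewer than \<open>CARD('n)\<close> are present. They become the rows of
  \<open>Q\<close>.\<close>

lemma symmetric_matrix_diagonalizable:
  fixes A :: "real^'n^'n"
  assumes sym: "transpose A = A"
  obtains Q d where "orthogonal_matrix Q" "Q ** A ** transpose Q = diag_mat d"
proof -
  have "\<exists>S. finite S \<and> card S = k \<and> pairwise orthogonal S \<and>
      (\<forall>v\<in>S. norm v = 1 \<and> (\<exists>c. A *v v = c *\<^sub>R v))" if "k \<le> CARD('n)" for k
    using that
  proof (induction k)
    case 0
    show ?case by (intro exI[of _ "{}"]) auto
  next
    case (Suc k)
    then obtain S where S: "finite S" "card S = k" "pairwise orthogonal S"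
      "\<And>v. v \<in> S \<Longrightarrow> norm v = 1 \<and> (\<exists>c. A *v v = c *\<^sub>R v)" by auto
    obtain v c where v: "norm v = 1" "A *v v = c *\<^sub>R v" "\<And>s. s \<in> S \<Longrightarrow> orthogonal v s"
      using symmetric_matrix_eigenvector_orthogonal[OF sym, of S] S Suc.prems
      by (metis Suc_le_eq)
    have "v \<notin> S"
      using v by (metis norm_zero orthogonal_self zero_neq_one)
    moreover have "pairwise orthogonal (insert v S)"
      using S(3) v(3) by (rule pairwise_orthogonal_insert)
    moreover have "\<forall>u\<in>insert v S. norm u = 1 \<and> (\<exists>c. A *v u = c *\<^sub>R u)"
      using S(4) v(1,2) by blast
    moreover have "finite (insert v S)" "card (insert v S) = Suc k"
      using S(1,2) \<open>v \<notin> S\<close> by auto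
    ultimately show ?case by blast
  qed
  from this[OF order_refl]
  obtain S where S: "finite S" "card S = CARD('n)" "pairwise orthogonal S"
    "\<And>v. v \<in> S \<Longrightarrow> norm v = 1 \<and> (\<exists>c. A *v v = c *\<^sub>R v)" by auto
  obtain f :: "'n \<Rightarrow> real^'n" where f: "bij_betw f UNIV S"
    using S by (metis finite_same_card_bij finite_class.finite_UNIV)
  have fS: "f i \<in> S" for i using f bij_betwE by blast
  have "\<forall>i. \<exists>c. A *v f i = c *\<^sub>R f i" using S(4) fS by blast
  then obtain d where d: "\<And>i. A *v f i = d i *\<^sub>R f i" by metis
  have ortho: "f i \<bullet> f j = (if i = j then 1 else 0)" for i j
  proof (cases "i = j")
    case True
    then show ?thesis using S(4)[OF fS[of i]] by (simp add: norm_eq_1)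
  next
    case False
    then have "f i \<noteq> f j" using f by (auto simp: bij_betw_def inj_on_def)
    then show ?thesis using False S(3) fS by (auto simp: pairwise_def orthogonal_def)
  qed
  define Q where "Q = (\<chi> i. f i)"
  have "orthogonal_matrix Q"
    unfolding orthogonal_matrix_orthonormal_rows
    by (auto simp: Q_def row_def orthogonal_def norm_eq_1 ortho)
  moreover have "Q ** A ** transpose Q = diag_mat d"
  proof -
    have "(Q ** A ** transpose Q) $ i $ j = f i \<bullet> (A *v f j)" for i j
    proof -
      have "(Q ** (A ** transpose Q)) $ i $ j = (\<Sum>k\<in>UNIV. f i $ k * (\<Sum>l\<in>UNIV. A $ k $ l * f j $ l))"
        by (simp add: matrix_matrix_mult_def Q_def transpose_def)
      then show ?thesis
        by (simp add: inner_vec_def matrix_vector_mult_def matrix_mul_assoc)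
    qed
    then show ?thesis
      by (simp add: vec_eq_iff d ortho diag_mat_def)
  qed
  ultimately show ?thesis by (rule that)
qed

text \<open>\<open>d i\<close> is the value of the quadratic form of \<open>A\<close> at the
  \<open>i\<close>-th row of \<open>D\<close>, a nonzero vector because \<open>D\<close> is
  invertible.\<close>

lemma congruence_diag_pos:
  fixes A D :: "real^'n^'n"
  assumes A: "pos_def_mat A" and D: "invertible D" and diag: "D ** A ** transpose D = diag_mat d"
  shows "d i > 0"
proof -
  define x where "x = transpose D *v axis i 1"
  have "x \<noteq> 0"
  proof
    assume "x = 0"
    obtain E where "E ** transpose D = mat 1"
      using transpose_invertible[OF D] unfolding invertible_def by blast
    then have "axis i 1 = E *v x"
      by (simp add: x_def matrix_vector_mul_assoc del: transpose_matrix_vector)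
    then show False using \<open>x = 0\<close> by (simp add: axis_eq_0_iff)
  qed
  then have "0 < x \<bullet> (A *v x)" using A by (simp add: pos_def_mat_def)
  also have "x \<bullet> (A *v x) = axis i 1 \<bullet> ((D ** A ** transpose D) *v axis i 1)"
    unfolding x_def
    by (simp add: matrix_vector_mul_assoc inner_matrix_vector_mult[of "axis i 1" D, symmetric]
        matrix_mul_assoc del: transpose_matrix_vector)
  also have "\<dots> = d i"
    by (simp add: diag diag_mat_def inner_axis' matrix_vector_mult_basis column_def)
  finally show ?thesis .
qed

text \<open>Rotating and then rescaling by inverse square roots of the eigenvalues turns
  \<open>A\<close> into the identity. The image of \<open>B\<close> is diagonalised afterwards by an
  orthogonal \<open>R\<close>, which leaves the identity in place.\<close>

lemma simultaneous_diagonalization: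
  fixes A B :: "real^'n^'n"
  assumes A: "pos_def_mat A" and B: "pos_def_mat B"
  obtains D :: "real^'n^'n" and e where "invertible D" "D ** A ** transpose D = mat 1"
    "D ** B ** transpose D = diag_mat e" "\<forall>i. e i > 0"
proof -
  obtain Q d where Q: "orthogonal_matrix Q" and d: "Q ** A ** transpose Q = diag_mat d"
    using symmetric_matrix_diagonalizable A unfolding pos_def_mat_def by blast
  have Qinv: "invertible Q" using Q by (auto simp: orthogonal_matrix_def invertible_def)
  have d_pos: "d i > 0" for i by (rule congruence_diag_pos[OF A Qinv d])
  define E where "E = diag_mat (\<lambda>i. 1 / sqrt (d i))"
  have Einv: "invertible E"
    using d_pos by (simp add: E_def invertible_det_nz det_diag_mat less_imp_neq[symmetric])
  define C where "C = E ** Q"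
  have CA: "C ** A ** transpose C = mat 1"
  proof -
    have "C ** A ** transpose C = E ** (Q ** A ** transpose Q) ** E"
      by (simp add: C_def matrix_transpose_mul E_def transpose_diag_mat matrix_mul_assoc)
    also have "\<dots> = diag_mat (\<lambda>i. 1 / sqrt (d i) * d i * (1 / sqrt (d i)))"
      by (simp add: d E_def diag_mat_mult)
    also have "(\<lambda>i. 1 / sqrt (d i) * d i * (1 / sqrt (d i))) = (\<lambda>i. 1)"
      using d_pos by (auto simp: fun_eq_iff field_simps less_imp_le less_imp_neq[symmetric])
    finally show ?thesis by (simp add: diag_mat_one)
  qed
  have "transpose (C ** B ** transpose C) = C ** B ** transpose C"
    using B by (simp add: pos_def_mat_def matrix_transpose_mul matrix_mul_assoc)
  then obtain R e where R: "orthogonal_matrix R" and e: "R ** (C ** B ** transpose C) ** transpose R = diag_mat e"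
    by (rule symmetric_matrix_diagonalizable)
  define D where "D = R ** C"
  have Dinv: "invertible D"
    using det_orthogonal_matrix[OF R] Einv Qinv
    by (auto simp: D_def C_def invertible_det_nz det_mul)
  have DB: "D ** B ** transpose D = diag_mat e"
    using e by (simp add: D_def matrix_transpose_mul matrix_mul_assoc)
  have "D ** A ** transpose D = R ** (C ** A ** transpose C) ** transpose R"
    by (simp add: D_def matrix_transpose_mul matrix_mul_assoc)
  then have "D ** A ** transpose D = mat 1"
    using R by (simp add: CA orthogonal_matrix_def)
  then show ?thesis
    using that Dinv DB congruence_diag_pos[OF B Dinv DB] by blast
qed

text \<open>\<open>A\<close> is congruent to the identity, so its determinant is the reciprocal of a
  square.\<close>

lemma pos_def_mat_det_pos:
  fixes A :: "real^'n^'n"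
  assumes "pos_def_mat A"
  shows "det A > 0"
proof -
  obtain D :: "real^'n^'n" and e where "invertible D" and D: "D ** A ** transpose D = mat 1"
    and "D ** A ** transpose D = diag_mat e" "\<forall>i. e i > 0"
    by (rule simultaneous_diagonalization[OF assms assms])
  from arg_cong[OF D, of det] have "(det D)\<^sup>2 * det A = 1"
    by (simp add: det_mul power2_eq_square mult_ac)
  then show ?thesis
    by (metis linorder_not_less mult_nonneg_nonpos not_one_le_zero zero_le_power2)
qed

text \<open>After simultaneous diagonalisation the difference of the two sides is a sum of terms
  \<open>(e i - 1 - ln (e i)) / 2\<close>.\<close>

lemma H_fun_less:
  fixes S S0 :: "real^'n^'n"
  assumes S: "pos_def_mat S" and S0: "pos_def_mat S0" and ne: "S \<noteq> S0"
  shows "H_fun S0 S < H_fun S0 S0"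
proof -
  obtain D :: "real^'n^'n" and e where D: "invertible D" and DS: "D ** S ** transpose D = mat 1"
    and DS0: "D ** S0 ** transpose D = diag_mat e" and "\<forall>i. e i > 0"
    by (rule simultaneous_diagonalization[OF S S0])
  then have e: "e i > 0" for i by blast
  have "transpose D ** (D ** S) = mat 1"
    using DS matrix_left_right_inverse by blast
  then have inv: "matrix_inv S = transpose D ** D"
    by (intro matrix_inv_unique) (simp add: matrix_mul_assoc)
  have "trace (transpose D ** (D ** S0)) = trace ((D ** S0) ** transpose D)"
    by (rule trace_mul_sym)
  then have tr: "trace (matrix_inv S ** S0) = (\<Sum>i\<in>UNIV. e i)"
    by (simp add: inv DS0 trace_diag_mat matrix_mul_assoc)
  have tr0: "trace (matrix_inv S0 ** S0) = (\<Sum>i\<in>(UNIV::'n set). 1)"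
    using pos_def_mat_det_pos[OF S0] by (simp add: matrix_inv_mult_left invertible_det_nz trace_I)
  have detD: "(det D)\<^sup>2 > 0" using D by (simp add: invertible_det_nz)
  have "(det D)\<^sup>2 * det S = 1"
    using arg_cong[OF DS, of det] by (simp add: det_mul power2_eq_square mult_ac)
  then have 1: "ln ((det D)\<^sup>2) + ln (det S) = 0"
    using ln_mult_pos[OF detD pos_def_mat_det_pos[OF S]] by simp
  have "(det D)\<^sup>2 * det S0 = (\<Prod>i\<in>UNIV. e i)"
    using arg_cong[OF DS0, of det] by (simp add: det_mul power2_eq_square mult_ac det_diag_mat)
  then have 2: "ln ((det D)\<^sup>2) + ln (det S0) = (\<Sum>i\<in>UNIV. ln (e i))"
    using ln_mult_pos[OF detD pos_def_mat_det_pos[OF S0]] ln_prod[of UNIV e] less_imp_neq[OF e, symmetric] by simp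
  \<comment> \<open>Source of strictness: if every \<open>e i\<close> were 1, then \<open>S0\<close>
    and \<open>S\<close> would have the same image under the congruence by the invertible matrix
    \<open>D\<close>.\<close>
  have "\<exists>i. e i \<noteq> 1"
  proof (rule ccontr)
    assume "\<nexists>i. e i \<noteq> 1"
    then have "e = (\<lambda>i. 1)" by auto
    then have "D ** S0 ** transpose D = D ** S ** transpose D"
      using DS DS0 by (simp add: diag_mat_one)
    then have "matrix_inv D ** (D ** S0 ** transpose D) ** matrix_inv (transpose D) =
        matrix_inv D ** (D ** S ** transpose D) ** matrix_inv (transpose D)" by simp
    moreover have "matrix_inv D ** (D ** B ** transpose D) ** matrix_inv (transpose D) = B" for B
    proof -
      have "matrix_inv D ** (D ** B ** transpose D) ** matrix_inv (transpose D) =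
          (matrix_inv D ** D) ** B ** (transpose D ** matrix_inv (transpose D))"
        by (simp add: matrix_mul_assoc)
      then show ?thesis
        by (simp add: matrix_inv_mult_left matrix_inv_mult_right D transpose_invertible)
    qed
    ultimately have "S0 = S" by simp
    then show False using ne by simp
  qed
  then obtain k where k: "e k \<noteq> 1" by blast
  have "(\<Sum>i\<in>UNIV. ln (e i)) < (\<Sum>i\<in>UNIV. e i - 1)"
  proof (rule sum_strict_mono_ex1)
    show "\<forall>i\<in>UNIV. ln (e i) \<le> e i - 1" using e ln_le_minus_one by blast
    have "ln (e k) < e k - 1"
      using k ln_le_minus_one[OF e[of k]] ln_eq_minus_one[OF e[of k]] by linarith
    then show "\<exists>i\<in>UNIV. ln (e i) < e i - 1" by blast
  qed simp
  then show ?thesis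
    using 1 2 tr tr0 by (simp add: H_fun_def sum_subtractf)
qed

section \<open>The covariance matrix of the model and the information criterion\<close>

text \<open>Vertical concatenation. It gives each noise one loading matrix into the whole
  observation vector and turns the block formula for the covariance into a sum of Gram
  matrices.\<close>

definition stack_rows :: "real^'c^'a \<Rightarrow> real^'c^'b \<Rightarrow> real^'c^('a + 'b)" where
  "stack_rows A B = (\<chi> i. case i of Inl a \<Rightarrow> A $ a | Inr b \<Rightarrow> B $ b)"

lemma stack_rows_nth [simp]:
  "stack_rows A B $ Inl a = A $ a" "stack_rows A B $ Inr b = B $ b"
  by (simp_all add: stack_rows_def)

lemma stack_rows_mult: "stack_rows A B ** C = stack_rows (A ** C) (B ** C)"
  by (simp add: vec_eq_iff stack_rows_def matrix_matrix_mult_def split: sum.splits)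

lemma stack_rows_mult_vec: "stack_rows A B *v x = block_vec (A *v x) (B *v x)"
  by (simp add: vec_eq_iff stack_rows_def block_vec_def matrix_vector_mult_def split: sum.splits)

lemma stack_rows_mult_transpose:
  "stack_rows A B ** transpose (stack_rows C D) =
    block_mat (A ** transpose C) (A ** transpose D) (B ** transpose C) (B ** transpose D)"
  by (simp add: vec_eq_iff stack_rows_def block_mat_def matrix_matrix_mult_def transpose_def
      split: sum.splits)

lemma block_mat_add:
  "block_mat A B C D + block_mat A' B' C' D' = block_mat (A + A') (B + B') (C + C') (D + D')"
  by (simp add: vec_eq_iff block_mat_def split: sum.splits)

lemma block_vec_add: "block_vec u v + block_vec u' v' = block_vec (u + u') (v + v')"
  by (simp add: vec_eq_iff block_vec_def split: sum.splits)

lemma matrix_mult_zero [simp]: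
  fixes A :: "real^'n^'m"
  shows "A ** (0 :: real^'k^'n) = 0" "(0 :: real^'m^'k) ** A = 0" "transpose (0 :: real^'n^'m) = 0"
    "(0 :: real^'n^'m) *v x = 0"
  by (simp_all add: vec_eq_iff matrix_matrix_mult_def matrix_vector_mult_def transpose_def)

lemma matrix_mult_add_rdistrib:
  fixes A B :: "real^'n^'m" and C :: "real^'k^'n"
  shows "(A + B) ** C = A ** C + B ** C"
  by (simp add: vec_eq_iff matrix_matrix_mult_def distrib_right sum.distrib)

lemma matrix_mult_transpose_nth:
  fixes A :: "real^'n^'m"
  shows "(A ** transpose A) $ i $ j = A $ i \<bullet> A $ j"
  by (simp add: matrix_matrix_mult_def transpose_def inner_vec_def)

lemma inner_gram_mult:
  fixes A :: "real^'n^'m"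
  shows "x \<bullet> ((A ** transpose A) *v x) = (norm (transpose A *v x))\<^sup>2"
  by (simp add: matrix_vector_mul_assoc[symmetric] inner_matrix_vector_mult power2_norm_eq_inner
      del: transpose_matrix_vector)

text \<open>The loadings of the observable process on \<open>W1\<close>, \<open>W2\<close>, \<open>W3\<close>, \<open>W4\<close>.\<close>

definition load1 :: "('p1::finite, 'p2::finite, 'k1::finite, 'k2::finite, 'r1::finite, 'r2::finite, 'r3::finite, 'r4::finite) sem_params
    \<Rightarrow> real^'r1^('p1 + 'p2)" where
  "load1 a = stack_rows (Lam1 a ** S1 a) (Lam2 a ** matrix_inv (Psi a) ** Gam a ** S1 a)"

definition load2 :: "('p1::finite, 'p2::finite, 'k1::finite, 'k2::finite, 'r1::finite, 'r2::finite, 'r3::finite, 'r4::finite) sem_params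
    \<Rightarrow> real^'r2^('p1 + 'p2)" where
  "load2 a = stack_rows (S2 a) 0"

definition load3 :: "('p1::finite, 'p2::finite, 'k1::finite, 'k2::finite, 'r1::finite, 'r2::finite, 'r3::finite, 'r4::finite) sem_params
    \<Rightarrow> real^'r3^('p1 + 'p2)" where
  "load3 a = stack_rows 0 (S3 a)"

definition load4 :: "('p1::finite, 'p2::finite, 'k1::finite, 'k2::finite, 'r1::finite, 'r2::finite, 'r3::finite, 'r4::finite) sem_params
    \<Rightarrow> real^'r4^('p1 + 'p2)" where
  "load4 a = stack_rows 0 (Lam2 a ** matrix_inv (Psi a) ** S4 a)"

text \<open>The right-hand side is the covariance at time 1 of the four loadings applied to
  independent standard Wiener processes and summed.\<close>

lemma Sigma_mat_eq_gram:
  "Sigma_mat a = load1 a ** transpose (load1 a) + load2 a ** transpose (load2 a) +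
    load3 a ** transpose (load3 a) + load4 a ** transpose (load4 a)"
  unfolding Sigma_mat_def Let_def load1_def load2_def load3_def load4_def
    stack_rows_mult_transpose block_mat_add
  by (simp add: matrix_transpose_mul matrix_mul_assoc matrix_add_ldistrib
      matrix_mult_add_rdistrib add_ac)

lemma Sigma_mat_nth:
  "Sigma_mat a $ i $ j = load1 a $ i \<bullet> load1 a $ j + load2 a $ i \<bullet> load2 a $ j +
    load3 a $ i \<bullet> load3 a $ j + load4 a $ i \<bullet> load4 a $ j"
  by (simp add: Sigma_mat_eq_gram matrix_mult_transpose_nth)

text \<open>The quadratic form is a sum of four squares. Those of \<open>load2\<close> and
  \<open>load3\<close> see the two blocks \<open>u\<close> and \<open>v\<close> of \<open>x\<close>
  separately; one block is nonzero, and admissibility makes its square positive.\<close>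

lemma pos_def_mat_Sigma_mat:
  fixes a :: "('p1::finite, 'p2::finite, 'k1::finite, 'k2::finite, 'r1::finite, 'r2::finite, 'r3::finite, 'r4::finite) sem_params"
  assumes "admissible a"
  shows "pos_def_mat (Sigma_mat a)"
  unfolding pos_def_mat_def
proof (intro conjI allI impI)
  show "transpose (Sigma_mat a) = Sigma_mat a"
    by (simp add: vec_eq_iff transpose_def Sigma_mat_nth inner_commute)
next
  fix x :: "real^('p1 + 'p2)" assume x: "x \<noteq> 0"
  define u :: "real^'p1" where "u = (\<chi> i. x $ Inl i)"
  define v :: "real^'p2" where "v = (\<chi> i. x $ Inr i)"
  have "u \<noteq> 0 \<or> v \<noteq> 0"
  proof (rule ccontr)
    assume "\<not> (u \<noteq> 0 \<or> v \<noteq> 0)"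
    then have "x $ i = 0" for i
      by (cases i) (auto simp: u_def v_def vec_eq_iff)
    then show False using x by (simp add: vec_eq_iff)
  qed
  moreover have split: "transpose (stack_rows A B) *v x = transpose A *v u + transpose B *v v"
    for A :: "real^'c^'p1" and B :: "real^'c^'p2"
  proof -
    have "(\<Sum>i\<in>UNIV. (case i of Inl a \<Rightarrow> A $ a | Inr b \<Rightarrow> B $ b) $ k * x $ i) =
        (\<Sum>i\<in>UNIV. A $ i $ k * x $ Inl i) + (\<Sum>i\<in>UNIV. B $ i $ k * x $ Inr i)" for k
      by (simp add: UNIV_Plus_UNIV[symmetric] sum.Plus del: UNIV_Plus_UNIV)
    then show ?thesis
      by (simp add: vec_eq_iff matrix_vector_mult_def transpose_def stack_rows_def u_def v_def
          del: transpose_matrix_vector)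
  qed
  ultimately have "(norm (transpose (load2 a) *v x))\<^sup>2 + (norm (transpose (load3 a) *v x))\<^sup>2 > 0"
  proof -
    have "(norm (transpose (load2 a) *v x))\<^sup>2 = u \<bullet> ((S2 a ** transpose (S2 a)) *v u)"
      by (simp add: load2_def split inner_gram_mult del: transpose_matrix_vector)
    moreover have "(norm (transpose (load3 a) *v x))\<^sup>2 = v \<bullet> ((S3 a ** transpose (S3 a)) *v v)"
      by (simp add: load3_def split inner_gram_mult del: transpose_matrix_vector)
    ultimately show ?thesis
      using assms \<open>u \<noteq> 0 \<or> v \<noteq> 0\<close> unfolding admissible_def pos_def_mat_def
      by (metis add_nonneg_pos add_pos_nonneg zero_le_power2)
  qed
  then have "0 < (norm (transpose (load1 a) *v x))\<^sup>2 + (norm (transpose (load2 a) *v x))\<^sup>2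
      + (norm (transpose (load3 a) *v x))\<^sup>2 + (norm (transpose (load4 a) *v x))\<^sup>2"
    using zero_le_power2[of "norm (transpose (load1 a) *v x)"]
      zero_le_power2[of "norm (transpose (load4 a) *v x)"] by linarith
  then show "0 < x \<bullet> (Sigma_mat a *v x)"
    by (simp add: Sigma_mat_eq_gram matrix_vector_mult_add_rdistrib inner_add_right inner_gram_mult
        del: transpose_matrix_vector)
qed

section \<open>The criterion as a function of the realized covariance\<close>

definition realized_cov :: "real \<Rightarrow> nat \<Rightarrow> (nat \<Rightarrow> real^'p) \<Rightarrow> real^'p^'p" where
  "realized_cov T n x = (\<chi> j k. (\<Sum>i = 1..n. (x i - x (i - 1)) $ j * (x i - x (i - 1)) $ k) / T)"

lemma trace_mult: "trace (A ** B) = (\<Sum>i\<in>UNIV. \<Sum>j\<in>UNIV. A $ i $ j * (B :: real^'n^'n) $ j $ i)"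
  by (simp add: trace_def matrix_matrix_mult_def)

text \<open>The exponents are linear in the outer squares, so the data enter only through their sum,
  \<open>T * realized_cov T n x\<close>. With step \<open>T / real n\<close> the resulting weight of
  the trace is \<open>n / 2\<close>; this is what the normalisation of the realized covariance by
  \<open>T\<close> achieves. The summand that contains neither \<open>S\<close> nor \<open>q\<close>
  is common to all models.\<close>

lemma QAIC_eq_H_fun:
  fixes S :: "real^'p^'p"
  assumes det: "det S > 0" and T: "T > 0" and n: "n \<ge> 1"
  shows "QAIC T n S q x =
    real n * (real CARD('p) * ln (2 * pi * T / real n) - 2 * H_fun (realized_cov T n x) S) + 2 * real q"
proof -
  define c where "c = 2 * pi * (T / real n)"
  have c: "c > 0" using T n by (simp add: c_def)
  define y where "y i = trace (matrix_inv S ** outer_square (x i - x (i - 1)))" for i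
  have y: "mat_bracket (matrix_inv S) (outer_square (x i - x (i - 1))) = y i" for i
  proof -
    have "transpose (outer_square z) = outer_square z" for z :: "real^'p"
      by (simp add: transpose_def outer_square_def vec_eq_iff mult.commute)
    then show ?thesis by (simp add: y_def mat_bracket_def)
  qed
  have "ln (quasi_lik T n S x) = (\<Sum>i = 1..n. ln (1 / (c powr (real CARD('p) / 2) * (det S) powr (1 / 2)) *
       exp (- (1 / (2 * (T / real n))) * y i)))"
    unfolding quasi_lik_def Let_def y c_def[symmetric]
    by (rule ln_prod) (use c det in auto)
  also have "\<dots> = (\<Sum>i = 1..n. (- (real CARD('p) / 2) * ln c - (1 / 2) * ln (det S)) - (real n / (2 * T)) * y i)"
    using c det by (intro sum.cong refl) (simp add: ln_mult_pos ln_div ln_powr)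
  also have "\<dots> = real n * (- (real CARD('p) / 2) * ln c - (1 / 2) * ln (det S)) - (real n / (2 * T)) * (\<Sum>i = 1..n. y i)"
    by (simp add: sum_subtractf sum_distrib_left)
  also have "(\<Sum>i = 1..n. y i) = T * trace (matrix_inv S ** realized_cov T n x)"
  proof -
    have "(\<Sum>i = 1..n. y i) = (\<Sum>j\<in>UNIV. \<Sum>k\<in>UNIV. \<Sum>i = 1..n.
        matrix_inv S $ j $ k * ((x i - x (i - 1)) $ k * (x i - x (i - 1)) $ j))"
      unfolding y_def trace_mult
      by (subst sum.swap, rule sum.cong[OF refl], subst sum.swap) (simp add: outer_square_def)
    then show ?thesis
      using T by (simp add: trace_mult realized_cov_def sum_distrib_left sum_divide_distrib)
  qed
  finally show ?thesis
    using T by (simp add: QAIC_def H_fun_def c_def algebra_simps)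
qed

text \<open>The log-determinants cancel and the trace is linear in the data matrix. What is left is
  half a sum over all pairs of indices of products bounded by \<open>C * d\<close>; the half is
  given away.\<close>

lemma H_fun_diff_le:
  fixes S S0 V :: "real^'p^'p"
  assumes "\<And>i j. \<bar>matrix_inv S $ i $ j\<bar> \<le> C" and "\<And>i j. \<bar>V $ i $ j - S0 $ i $ j\<bar> \<le> d"
  shows "\<bar>H_fun V S - H_fun S0 S\<bar> \<le> (real CARD('p))\<^sup>2 * (C * d)"
proof -
  have C: "C \<ge> 0" using assms(1)[of undefined undefined] by linarith
  have "H_fun S0 S - H_fun V S = (1 / 2) * (\<Sum>i\<in>UNIV. \<Sum>j\<in>UNIV. matrix_inv S $ i $ j * (V $ j $ i - S0 $ j $ i))"
    by (simp add: H_fun_def trace_mult right_diff_distrib sum_subtractf)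
  also have "\<bar>\<dots>\<bar> \<le> (\<Sum>i\<in>(UNIV::'p set). \<Sum>j\<in>(UNIV::'p set). C * d)"
  proof -
    have "\<bar>\<Sum>i\<in>UNIV. \<Sum>j\<in>UNIV. matrix_inv S $ i $ j * (V $ j $ i - S0 $ j $ i)\<bar> \<le> (\<Sum>i\<in>(UNIV::'p set). \<Sum>j\<in>(UNIV::'p set). C * d)"
      by (intro order.trans[OF sum_abs] sum_mono) (simp add: abs_mult mult_mono assms C)
    then show ?thesis by (simp add: abs_mult)
  qed
  finally show ?thesis by (simp add: power2_eq_square mult_ac abs_minus_commute)
qed

text \<open>At \<open>V = S0\<close> the maximum over \<open>K\<close> is attained and, by
  \<open>H_fun_less\<close>, lies strictly below the value at \<open>S0\<close>. Part of this margin
  survives small changes of \<open>V\<close>, uniformly in \<open>S\<close>, by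
  \<open>H_fun_diff_le\<close>.\<close>

lemma H_fun_uniform_gap:
  fixes K :: "(real^'p^'p) set"
  assumes K: "compact K" and pd: "\<And>S. S \<in> K \<Longrightarrow> pos_def_mat S" and S0: "pos_def_mat S0" "S0 \<notin> K"
  obtains g d where "g > 0" "d > 0"
    "\<And>V S. S \<in> K \<Longrightarrow> (\<And>i j. \<bar>V $ i $ j - S0 $ i $ j\<bar> \<le> d) \<Longrightarrow> H_fun V S + g \<le> H_fun V S0"
proof (cases "K = {}")
  case True
  then show ?thesis using that[of 1 1] by auto
next
  case False
  have det: "det S > 0" if "S \<in> insert S0 K" for S
    using that pd S0(1) pos_def_mat_det_pos by blast
  then have cont_inv: "continuous_on (insert S0 K) matrix_inv"
    by (intro continuous_on_matrix_inv[OF continuous_on_id]) (simp add: less_imp_neq[symmetric])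
  have "continuous_on K (H_fun S0)"
  proof -
    have "continuous_on K (\<lambda>S. matrix_inv S $ i $ j)" for i j
      by (intro continuous_intros continuous_on_subset[OF cont_inv]) auto
    moreover have "continuous_on K (\<lambda>S. ln (det S))"
      using det by (intro continuous_intros continuous_on_id) (simp add: less_imp_neq[symmetric])
    ultimately show ?thesis
      unfolding H_fun_def trace_mult
      by (intro continuous_on_diff continuous_on_mult continuous_on_const continuous_on_sum)
  qed
  then obtain S1 where S1: "S1 \<in> K" and max: "\<And>S. S \<in> K \<Longrightarrow> H_fun S0 S \<le> H_fun S0 S1"
    using continuous_attains_sup[OF K False] by blast
  \<comment> \<open>Half of the margin at \<open>V = S0\<close>; the other half pays for replacing
    \<open>S0\<close> by \<open>V\<close> in two places, at \<open>g / 2\<close> each.\<close>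
  define g where "g = (H_fun S0 S0 - H_fun S0 S1) / 2"
  have g: "g > 0" using H_fun_less[of S1 S0] pd S1 S0 by (auto simp: g_def)
  \<comment> \<open>\<open>S0\<close> is included because the value at \<open>S0\<close> is
    perturbed as well as the values on \<open>K\<close>.\<close>
  have "bounded (matrix_inv ` insert S0 K)"
    by (intro compact_imp_bounded compact_continuous_image cont_inv compact_insert K)
  then obtain C where C: "C > 0" "\<And>S. S \<in> insert S0 K \<Longrightarrow> norm (matrix_inv S) \<le> C"
    unfolding bounded_pos by auto
  have Cij: "\<bar>matrix_inv S $ i $ j\<bar> \<le> C" if "S \<in> insert S0 K" for S i j
    using component_le_norm_cart[of "matrix_inv S $ i" j]
      Finite_Cartesian_Product.norm_nth_le[of "matrix_inv S" i] C(2)[OF that] by linarith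
  \<comment> \<open>Chosen so that the bound of \<open>H_fun_diff_le\<close> becomes
    \<open>g / 2\<close>.\<close>
  define d where "d = g / (2 * (real CARD('p))\<^sup>2 * C)"
  have d: "d > 0" using g C by (simp add: d_def)
  have eq: "(real CARD('p))\<^sup>2 * (C * d) = g / 2" using C by (simp add: d_def)
  show ?thesis
  proof (rule that[OF g d])
    fix V S assume S: "S \<in> K" and V: "\<And>i j. \<bar>V $ i $ j - S0 $ i $ j\<bar> \<le> d"
    have "\<bar>H_fun V S - H_fun S0 S\<bar> \<le> g / 2" "\<bar>H_fun V S0 - H_fun S0 S0\<bar> \<le> g / 2"
      using H_fun_diff_le[of S C V S0 d, OF Cij V] H_fun_diff_le[of S0 C V S0 d, OF Cij V] S eq
      by auto
    then show "H_fun V S + g \<le> H_fun V S0"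
      using max[OF S] unfolding g_def by argo
  qed
qed

section \<open>Convergence in probability and Gaussian moments\<close>

text \<open>Convergence to zero in probability. Measurability is built in so that the union bound
  for sums deals with measurable events.\<close>

definition null_in_prob :: "'a measure \<Rightarrow> (nat \<Rightarrow> 'a \<Rightarrow> real) \<Rightarrow> bool" where
  "null_in_prob P Y \<longleftrightarrow> (\<forall>n. Y n \<in> borel_measurable P) \<and>
     (\<forall>e>0. (\<lambda>n. measure P {\<omega> \<in> space P. e \<le> \<bar>Y n \<omega>\<bar>}) \<longlonglongrightarrow> 0)"

context prob_space begin

lemma null_in_prob_cmult:
  assumes "null_in_prob M Y"
  shows "null_in_prob M (\<lambda>n \<omega>. c * Y n \<omega>)"
proof (cases "c = 0")
  case True
  then show ?thesis by (auto simp: null_in_prob_def)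
next
  case False
  have "(\<lambda>n. prob {\<omega> \<in> space M. e \<le> \<bar>c * Y n \<omega>\<bar>}) \<longlonglongrightarrow> 0" if "e > 0" for e
  proof -
    have "e \<le> \<bar>c * Y n \<omega>\<bar> \<longleftrightarrow> e / \<bar>c\<bar> \<le> \<bar>Y n \<omega>\<bar>" for n \<omega>
      using False by (simp add: abs_mult divide_le_eq mult.commute)
    moreover have "e / \<bar>c\<bar> > 0" using False that by simp
    ultimately show ?thesis using assms by (simp add: null_in_prob_def)
  qed
  moreover have "(\<lambda>\<omega>. c * Y n \<omega>) \<in> borel_measurable M" for n
    using assms by (intro borel_measurable_times) (auto simp: null_in_prob_def)
  ultimately show ?thesis by (simp add: null_in_prob_def)
qed

lemma null_in_prob_add:
  assumes "null_in_prob M Y" "null_in_prob M Z"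
  shows "null_in_prob M (\<lambda>n \<omega>. Y n \<omega> + Z n \<omega>)"
proof -
  have [measurable]: "Y n \<in> borel_measurable M" "Z n \<in> borel_measurable M" for n
    using assms by (auto simp: null_in_prob_def)
  have "(\<lambda>n. prob {\<omega> \<in> space M. e \<le> \<bar>Y n \<omega> + Z n \<omega>\<bar>}) \<longlonglongrightarrow> 0" if e: "e > 0" for e
  proof (rule tendsto_sandwich[OF _ _ tendsto_const])
    have "prob {\<omega> \<in> space M. e \<le> \<bar>Y n \<omega> + Z n \<omega>\<bar>} \<le>
        prob {\<omega> \<in> space M. e / 2 \<le> \<bar>Y n \<omega>\<bar>} + prob {\<omega> \<in> space M. e / 2 \<le> \<bar>Z n \<omega>\<bar>}" for n
    proof -
      have "prob {\<omega> \<in> space M. e \<le> \<bar>Y n \<omega> + Z n \<omega>\<bar>} \<le>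
          prob ({\<omega> \<in> space M. e / 2 \<le> \<bar>Y n \<omega>\<bar>} \<union> {\<omega> \<in> space M. e / 2 \<le> \<bar>Z n \<omega>\<bar>})"
        by (rule finite_measure_mono) auto
      also have "\<dots> \<le> prob {\<omega> \<in> space M. e / 2 \<le> \<bar>Y n \<omega>\<bar>} + prob {\<omega> \<in> space M. e / 2 \<le> \<bar>Z n \<omega>\<bar>}"
        by (rule measure_Un_le) auto
      finally show ?thesis .
    qed
    then show "\<forall>\<^sub>F n in sequentially. prob {\<omega> \<in> space M. e \<le> \<bar>Y n \<omega> + Z n \<omega>\<bar>} \<le>
        prob {\<omega> \<in> space M. e / 2 \<le> \<bar>Y n \<omega>\<bar>} + prob {\<omega> \<in> space M. e / 2 \<le> \<bar>Z n \<omega>\<bar>}"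
      by simp
    show "(\<lambda>n. prob {\<omega> \<in> space M. e / 2 \<le> \<bar>Y n \<omega>\<bar>} + prob {\<omega> \<in> space M. e / 2 \<le> \<bar>Z n \<omega>\<bar>}) \<longlonglongrightarrow> 0"
      using assms half_gt_zero[OF e] unfolding null_in_prob_def by (intro tendsto_add_zero) blast+
  qed simp
  then show ?thesis by (auto simp: null_in_prob_def)
qed

lemma null_in_prob_sum:
  assumes "finite I" "\<And>i. i \<in> I \<Longrightarrow> null_in_prob M (Y i)"
  shows "null_in_prob M (\<lambda>n \<omega>. \<Sum>i\<in>I. Y i n \<omega>)"
  using assms
proof (induction I)
  case empty
  then show ?case by (auto simp: null_in_prob_def)
next
  case (insert i I)
  then show ?case by (simp add: null_in_prob_add)
qed

text \<open>Along almost every path the indicators of the exceptional events are eventually zero;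
  they are dominated by 1, so their expectations tend to zero.\<close>

lemma null_in_prob_AE:
  assumes [measurable]: "\<And>n. Y n \<in> borel_measurable M"
    and lim: "AE \<omega> in M. (\<lambda>n. Y n \<omega>) \<longlonglongrightarrow> 0"
  shows "null_in_prob M Y"
proof -
  have "(\<lambda>n. prob {\<omega> \<in> space M. e \<le> \<bar>Y n \<omega>\<bar>}) \<longlonglongrightarrow> 0" if e: "e > 0" for e
  proof -
    have "(\<lambda>n. \<integral>\<omega>. indicator {\<omega> \<in> space M. e \<le> \<bar>Y n \<omega>\<bar>} \<omega> \<partial>M) \<longlonglongrightarrow> (\<integral>\<omega>. 0 \<partial>M :: real)"
    proof (rule integral_dominated_convergence[where w = "\<lambda>_. 1"])
      show "AE \<omega> in M. (\<lambda>n. indicator {\<omega> \<in> space M. e \<le> \<bar>Y n \<omega>\<bar>} \<omega> :: real) \<longlonglongrightarrow> 0"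
        using lim
      proof eventually_elim
        case (elim \<omega>)
        have "\<forall>\<^sub>F n in sequentially. \<bar>Y n \<omega>\<bar> < e"
          using tendstoD[OF elim e] by simp
        then have "\<forall>\<^sub>F n in sequentially. indicator {\<omega> \<in> space M. e \<le> \<bar>Y n \<omega>\<bar>} \<omega> = (0::real)"
          by eventually_elim (auto simp: indicator_def)
        then show ?case by (rule tendsto_eventually)
      qed
    qed (auto simp: indicator_def)
    then show ?thesis by simp
  qed
  then show ?thesis by (auto simp: null_in_prob_def)
qed

text \<open>Chebyshev's inequality. The bounds are asked for \<open>n \<ge> 1\<close> only, since
  \<open>C / real 0\<close> is 0 and would demand too much.\<close>

lemma null_in_prob_L2:
  assumes [measurable]: "\<And>n. Y n \<in> borel_measurable M"
    and int: "\<And>n. n \<ge> 1 \<Longrightarrow> integrable M (\<lambda>\<omega>. (Y n \<omega>)\<^sup>2)"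
    and bound: "\<And>n. n \<ge> 1 \<Longrightarrow> expectation (\<lambda>\<omega>. (Y n \<omega>)\<^sup>2) \<le> C / real n"
  shows "null_in_prob M Y"
proof -
  have "(\<lambda>n. prob {\<omega> \<in> space M. e \<le> \<bar>Y n \<omega>\<bar>}) \<longlonglongrightarrow> 0" if e: "e > 0" for e
  proof (rule tendsto_sandwich[OF _ _ tendsto_const])
    have "prob {\<omega> \<in> space M. e \<le> \<bar>Y n \<omega>\<bar>} \<le> C / e\<^sup>2 * (1 / real n)" if n: "n \<ge> 1" for n
    proof -
      have "prob {\<omega> \<in> space M. e \<le> \<bar>Y n \<omega>\<bar>} \<le> expectation (\<lambda>\<omega>. (Y n \<omega>)\<^sup>2) / e\<^sup>2"
        by (rule second_moment_method) (use int n e in auto)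
      also have "\<dots> \<le> C / real n / e\<^sup>2"
        by (intro divide_right_mono bound n) simp
      finally show ?thesis by (simp add: mult.commute)
    qed
    then show "\<forall>\<^sub>F n in sequentially. prob {\<omega> \<in> space M. e \<le> \<bar>Y n \<omega>\<bar>} \<le> C / e\<^sup>2 * (1 / real n)"
      using eventually_ge_at_top[of 1] by (rule eventually_mono[rotated])
    show "(\<lambda>n. C / e\<^sup>2 * (1 / real n)) \<longlonglongrightarrow> 0"
      using tendsto_mult_right_zero[OF lim_1_over_n] by blast
  qed simp
  then show ?thesis by (auto simp: null_in_prob_def)
qed

lemma second_moment_sum_uncorrelated:
  assumes fin: "finite I"
    and int: "\<And>i j. i \<in> I \<Longrightarrow> j \<in> I \<Longrightarrow> integrable M (\<lambda>\<omega>. Z i \<omega> * Z j \<omega> :: real)"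
    and unc: "\<And>i j. i \<in> I \<Longrightarrow> j \<in> I \<Longrightarrow> i \<noteq> j \<Longrightarrow> expectation (\<lambda>\<omega>. Z i \<omega> * Z j \<omega>) = 0"
    and bound: "\<And>i. i \<in> I \<Longrightarrow> expectation (\<lambda>\<omega>. Z i \<omega> * Z i \<omega>) \<le> c"
  shows "integrable M (\<lambda>\<omega>. (\<Sum>i\<in>I. Z i \<omega>)\<^sup>2)"
    and "expectation (\<lambda>\<omega>. (\<Sum>i\<in>I. Z i \<omega>)\<^sup>2) \<le> real (card I) * c"
proof -
  have eq: "(\<Sum>i\<in>I. Z i \<omega>)\<^sup>2 = (\<Sum>i\<in>I. \<Sum>j\<in>I. Z i \<omega> * Z j \<omega>)" for \<omega>
    by (simp add: power2_eq_square sum_product)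
  show "integrable M (\<lambda>\<omega>. (\<Sum>i\<in>I. Z i \<omega>)\<^sup>2)"
    unfolding eq by (intro Bochner_Integration.integrable_sum int)
  have "expectation (\<lambda>\<omega>. (\<Sum>i\<in>I. Z i \<omega>)\<^sup>2) = (\<Sum>i\<in>I. \<Sum>j\<in>I. expectation (\<lambda>\<omega>. Z i \<omega> * Z j \<omega>))"
    unfolding eq by (subst Bochner_Integration.integral_sum Bochner_Integration.integrable_sum; simp add: int)+
  also have "\<dots> = (\<Sum>i\<in>I. expectation (\<lambda>\<omega>. Z i \<omega> * Z i \<omega>))"
  proof (rule sum.cong[OF refl])
    fix i assume i: "i \<in> I"
    have "(\<Sum>j\<in>I. expectation (\<lambda>\<omega>. Z i \<omega> * Z j \<omega>)) =
        (\<Sum>j\<in>I. if j = i then expectation (\<lambda>\<omega>. Z i \<omega> * Z i \<omega>) else 0)"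
      by (rule sum.cong[OF refl]) (use i unc in auto)
    then show "(\<Sum>j\<in>I. expectation (\<lambda>\<omega>. Z i \<omega> * Z j \<omega>)) = expectation (\<lambda>\<omega>. Z i \<omega> * Z i \<omega>)"
      using i fin by simp
  qed
  also have "\<dots> \<le> real (card I) * c"
    using sum_bounded_above[of I "\<lambda>i. expectation (\<lambda>\<omega>. Z i \<omega> * Z i \<omega>)" c] bound by simp
  finally show "expectation (\<lambda>\<omega>. (\<Sum>i\<in>I. Z i \<omega>)\<^sup>2) \<le> real (card I) * c" .
qed

end

text \<open>Fubini's theorem for product functions. Lebesgue measure on \<open>real^'n\<close> is
  the image of a product measure indexed by \<open>Basis\<close>, and \<open>k\<close> translates a
  basis vector back into its coordinate.\<close>

lemma
  fixes f :: "'n::finite \<Rightarrow> real \<Rightarrow> real"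
  assumes int: "\<And>i. integrable lborel (f i)"
  shows integrable_lborel_vec_prod: "integrable lborel (\<lambda>x::real^'n. \<Prod>i\<in>UNIV. f i (x $ i))"
    and integral_lborel_vec_prod:
      "(\<integral>x. (\<Prod>i\<in>UNIV. f i ((x :: real^'n) $ i)) \<partial>lborel) = (\<Prod>i\<in>UNIV. integral\<^sup>L lborel (f i))"
proof -
  let ?B = "Basis :: (real^'n) set"
  interpret product_sigma_finite "\<lambda>_::real^'n. lborel :: real measure" ..
  have [measurable]: "f i \<in> borel_measurable borel" for i
    using borel_measurable_integrable[OF int[of i]] by simp
  have inj: "inj (\<lambda>i::'n. axis i (1::real))" by (auto simp: inj_on_def axis_eq_axis)
  have B: "?B = range (\<lambda>i. axis i 1)" by (auto simp: Basis_vec_def)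
  define k where "k = the_inv (\<lambda>i::'n. axis i (1::real))"
  have k: "k (axis i 1) = i" for i unfolding k_def by (rule the_inv_f_f[OF inj])
  have nth: "(\<Sum>b\<in>?B. y b *\<^sub>R b) $ i = y (axis i 1)" for y i
  proof -
    have "(\<Sum>b\<in>?B. y b *\<^sub>R b) $ i = (\<Sum>j\<in>UNIV. y (axis j 1) * axis j 1 $ i)"
      unfolding B by (subst sum.reindex[OF inj]) simp
    also have "\<dots> = (\<Sum>j\<in>UNIV. if j = i then y (axis i 1) else 0)"
      by (rule sum.cong) (auto simp: axis_def)
    finally show ?thesis by simp
  qed
  have prod: "(\<Prod>i\<in>UNIV. f i ((\<Sum>b\<in>?B. y b *\<^sub>R b) $ i)) = (\<Prod>b\<in>?B. f (k b) (y b))" for y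
    unfolding nth unfolding B by (subst prod.reindex[OF inj]) (simp add: k)
  have int': "integrable (\<Pi>\<^sub>M b\<in>?B. lborel) (\<lambda>y. \<Prod>b\<in>?B. f (k b) (y b))"
    by (rule product_integrable_prod) (auto simp: int)
  have m1: "(\<lambda>y. \<Sum>b\<in>?B. y b *\<^sub>R b) \<in> borel_measurable (\<Pi>\<^sub>M b\<in>?B. lborel)"
    by measurable
  have m2: "(\<lambda>x::real^'n. \<Prod>i\<in>UNIV. f i (x $ i)) \<in> borel_measurable borel"
    by measurable
  show "integrable lborel (\<lambda>x::real^'n. \<Prod>i\<in>UNIV. f i (x $ i))"
    using integrable_distr_eq[OF m1 m2] int' by (simp only: prod lborel_eq[where 'a="real^'n"])
  have "(\<integral>x. (\<Prod>i\<in>UNIV. f i ((x :: real^'n) $ i)) \<partial>lborel) = (\<integral>y. (\<Prod>b\<in>?B. f (k b) (y b)) \<partial>(\<Pi>\<^sub>M b\<in>?B. lborel))"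
    using integral_distr[OF m1 m2] by (simp only: prod lborel_eq[where 'a="real^'n"])
  also have "\<dots> = (\<Prod>b\<in>?B. integral\<^sup>L lborel (f (k b)))"
    by (rule product_integral_prod) (auto simp: int)
  also have "\<dots> = (\<Prod>i\<in>UNIV. integral\<^sup>L lborel (f i))"
    unfolding B by (subst prod.reindex[OF inj]) (simp add: k)
  finally show "(\<integral>x. (\<Prod>i\<in>UNIV. f i ((x :: real^'n) $ i)) \<partial>lborel) = (\<Prod>i\<in>UNIV. integral\<^sup>L lborel (f i))" .
qed

definition normal_moment :: "real \<Rightarrow> nat \<Rightarrow> real" where
  "normal_moment \<sigma> k = (\<integral>x. normal_density 0 \<sigma> x * x ^ k \<partial>lborel)"

lemma normal_moment_simps:
  assumes "\<sigma> > 0"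
  shows "normal_moment \<sigma> 0 = 1" "normal_moment \<sigma> (Suc 0) = 0" "normal_moment \<sigma> 2 = \<sigma>\<^sup>2"
    "normal_moment \<sigma> 4 = 3 * \<sigma> ^ 4"
  using integral_normal_moment_even[OF assms, of 0 0] integral_normal_moment_odd[OF assms, of 0 0]
    integral_normal_moment_even[OF assms, of 0 1] integral_normal_moment_even[OF assms, of 0 2] assms
  by (simp_all add: normal_moment_def fact_numeral field_simps power2_eq_square power4_eq_xxxx)

text \<open>Density and monomial both factor over the coordinates. All moments of Wiener increments
  used later are instances for suitable exponents \<open>k\<close>.\<close>

lemma (in prob_space)
  fixes U :: "'a \<Rightarrow> real^'n::finite" and k :: "'n \<Rightarrow> nat"
  assumes D: "distributed M lborel U (\<lambda>x. ennreal (\<Prod>i\<in>UNIV. normal_density 0 \<sigma> (x $ i)))"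
    and \<sigma>: "\<sigma> > 0"
  shows integrable_gaussian_monomial: "integrable M (\<lambda>\<omega>. \<Prod>i\<in>UNIV. (U \<omega> $ i) ^ k i)"
    and expectation_gaussian_monomial:
      "expectation (\<lambda>\<omega>. \<Prod>i\<in>UNIV. (U \<omega> $ i) ^ k i) = (\<Prod>i\<in>UNIV. normal_moment \<sigma> (k i))"
proof -
  have int: "integrable lborel (\<lambda>x. normal_density 0 \<sigma> x * x ^ m)" for m
    using integrable_normal_moment[OF \<sigma>, of 0 m] by simp
  have nn: "(\<Prod>i\<in>UNIV. normal_density 0 \<sigma> (x $ i)) \<ge> 0" for x :: "real^'n"
    by (intro prod_nonneg) simp
  have eq: "(\<Prod>i\<in>UNIV. normal_density 0 \<sigma> (x $ i)) * (\<Prod>i\<in>UNIV. (x $ i) ^ k i) =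
      (\<Prod>i\<in>UNIV. normal_density 0 \<sigma> (x $ i) * (x $ i) ^ k i)" for x :: "real^'n"
    by (simp add: prod.distrib)
  have "integrable lborel (\<lambda>x::real^'n. (\<Prod>i\<in>UNIV. normal_density 0 \<sigma> (x $ i)) * (\<Prod>i\<in>UNIV. (x $ i) ^ k i))"
    unfolding eq by (rule integrable_lborel_vec_prod[OF int])
  then show "integrable M (\<lambda>\<omega>. \<Prod>i\<in>UNIV. (U \<omega> $ i) ^ k i)"
    by (subst (asm) distributed_integrable[OF D]) (auto simp: nn)
  have "(\<integral>x. (\<Prod>i\<in>UNIV. normal_density 0 \<sigma> ((x :: real^'n) $ i)) * (\<Prod>i\<in>UNIV. (x $ i) ^ k i) \<partial>lborel) =
      expectation (\<lambda>\<omega>. \<Prod>i\<in>UNIV. (U \<omega> $ i) ^ k i)"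
    by (rule distributed_integral[OF D]) (auto simp: nn)
  then show "expectation (\<lambda>\<omega>. \<Prod>i\<in>UNIV. (U \<omega> $ i) ^ k i) = (\<Prod>i\<in>UNIV. normal_moment \<sigma> (k i))"
    unfolding eq by (simp add: integral_lborel_vec_prod[OF int] normal_moment_def)
qed

lemma prod_power_indicator:
  fixes u :: "'n::finite \<Rightarrow> real"
  shows "(\<Prod>i\<in>UNIV. u i ^ (if i = a then m else 0)) = u a ^ m"
proof -
  have "(\<Prod>i\<in>UNIV. u i ^ (if i = a then m else 0)) = (\<Prod>i\<in>UNIV. if i = a then u a ^ m else 1)"
    by (rule prod.cong) auto
  then show ?thesis by simp
qed

text \<open>These are monomials with exponents supported on \<open>a\<close> and \<open>b\<close>.
  The last bound is the fourth moment of a normal variable, attained for \<open>a = b\<close>; for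
  distinct coordinates the value is \<sigma> to the fourth power.\<close>

lemma (in prob_space)
  fixes U :: "'a \<Rightarrow> real^'n::finite"
  assumes D: "distributed M lborel U (\<lambda>x. ennreal (\<Prod>i\<in>UNIV. normal_density 0 \<sigma> (x $ i)))"
    and \<sigma>: "\<sigma> > 0"
  shows integrable_gaussian_component: "integrable M (\<lambda>\<omega>. U \<omega> $ a)"
    and expectation_gaussian_component: "expectation (\<lambda>\<omega>. U \<omega> $ a) = 0"
    and integrable_gaussian_mult: "integrable M (\<lambda>\<omega>. U \<omega> $ a * U \<omega> $ b)"
    and expectation_gaussian_mult: "expectation (\<lambda>\<omega>. U \<omega> $ a * U \<omega> $ b) = (if a = b then \<sigma>\<^sup>2 else 0)"
    and integrable_gaussian_mult_sq: "integrable M (\<lambda>\<omega>. (U \<omega> $ a * U \<omega> $ b)\<^sup>2)"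
    and expectation_gaussian_mult_sq: "expectation (\<lambda>\<omega>. (U \<omega> $ a * U \<omega> $ b)\<^sup>2) \<le> 3 * \<sigma> ^ 4"
proof -
  note mom = normal_moment_simps[OF \<sigma>]
  have mom2: "normal_moment \<sigma> (Suc (Suc 0)) = \<sigma>\<^sup>2"
    using mom(3) by (simp only: numeral_2_eq_2)
  note I = integrable_gaussian_monomial[OF D \<sigma>] and E = expectation_gaussian_monomial[OF D \<sigma>]
  \<comment> \<open>Adding the exponents at \<open>a\<close> and \<open>b\<close> lets one formula
    serve both cases: for \<open>a = b\<close> the exponent doubles.\<close>
  have two: "(\<Prod>i\<in>UNIV. u i ^ ((if i = a then m else 0) + (if i = b then m else 0))) = (u a * u b) ^ m"
    for u :: "'n \<Rightarrow> real" and m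
    by (simp add: power_add prod.distrib prod_power_indicator power_mult_distrib)
  have one: "(\<Prod>i\<in>UNIV. u i ^ (if i = a then 1 else 0)) = u a" for u :: "'n \<Rightarrow> real"
    using prod_power_indicator[of u a 1] by simp
  show "integrable M (\<lambda>\<omega>. U \<omega> $ a)"
    using I[of "\<lambda>i. if i = a then 1 else 0"] unfolding one by simp
  have "(\<Prod>i\<in>UNIV. normal_moment \<sigma> (if i = a then 1 else 0)) = 0"
    by (rule prod_zero) (auto simp: mom intro!: bexI[of _ a])
  then show "expectation (\<lambda>\<omega>. U \<omega> $ a) = 0"
    using E[of "\<lambda>i. if i = a then 1 else 0"] unfolding one by simp
  show "integrable M (\<lambda>\<omega>. U \<omega> $ a * U \<omega> $ b)"
    using I[of "\<lambda>i. (if i = a then 1 else 0) + (if i = b then 1 else 0)"] unfolding two by simp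
  show "integrable M (\<lambda>\<omega>. (U \<omega> $ a * U \<omega> $ b)\<^sup>2)"
    using I[of "\<lambda>i. (if i = a then 2 else 0) + (if i = b then 2 else 0)"] unfolding two .
  have "(\<Prod>i\<in>UNIV. normal_moment \<sigma> ((if i = a then 1 else 0) + (if i = b then 1 else 0))) =
      (if a = b then \<sigma>\<^sup>2 else 0)"
  proof (cases "a = b")
    case True
    then have "(\<Prod>i\<in>UNIV. normal_moment \<sigma> ((if i = a then 1 else 0) + (if i = b then 1 else 0))) =
      (\<Prod>i\<in>UNIV. if i = a then \<sigma>\<^sup>2 else 1)"
      by (intro prod.cong refl) (simp add: mom mom2)
    then show ?thesis using True by simp
  next
    case False
    then have "(\<Prod>i\<in>UNIV. normal_moment \<sigma> ((if i = a then 1 else 0) + (if i = b then 1 else 0))) = 0"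
      by (intro prod_zero) (auto simp: mom intro!: bexI[of _ a])
    then show ?thesis using False by simp
  qed
  then show "expectation (\<lambda>\<omega>. U \<omega> $ a * U \<omega> $ b) = (if a = b then \<sigma>\<^sup>2 else 0)"
    using E[of "\<lambda>i. (if i = a then 1 else 0) + (if i = b then 1 else 0)"] unfolding two by simp
  have "(\<Prod>i\<in>UNIV. normal_moment \<sigma> ((if i = a then 2 else 0) + (if i = b then 2 else 0))) \<le> 3 * \<sigma> ^ 4"
  proof (cases "a = b")
    case True
    then have "(\<Prod>i\<in>UNIV. normal_moment \<sigma> ((if i = a then 2 else 0) + (if i = b then 2 else 0))) =
      (\<Prod>i\<in>UNIV. if i = a then 3 * \<sigma> ^ 4 else 1)"
      by (intro prod.cong refl) (simp add: mom)
    then show ?thesis by simp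
  next
    case False
    then have "(\<Prod>i\<in>UNIV. normal_moment \<sigma> ((if i = a then 2 else 0) + (if i = b then 2 else 0))) =
      (\<Prod>i\<in>UNIV. (if i = a then \<sigma>\<^sup>2 else 1) * (if i = b then \<sigma>\<^sup>2 else 1))"
      by (intro prod.cong refl) (auto simp add: mom mom2)
    also have "\<dots> = \<sigma> ^ 4" by (simp add: prod.distrib power2_eq_square power4_eq_xxxx)
    finally show ?thesis using \<sigma> by simp
  qed
  then show "expectation (\<lambda>\<omega>. (U \<omega> $ a * U \<omega> $ b)\<^sup>2) \<le> 3 * \<sigma> ^ 4"
    using E[of "\<lambda>i. (if i = a then 2 else 0) + (if i = b then 2 else 0)"] unfolding two by simp
qed

section \<open>Realized covariation of Wiener processes\<close>

lemma borel_measurable_component: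
  fixes f :: "'a \<Rightarrow> real^'n"
  assumes "f \<in> borel_measurable M"
  shows "(\<lambda>x. f x $ i) \<in> borel_measurable M"
  using assms by (rule measurable_compose) (intro borel_measurable_continuous_onI continuous_intros)

definition grid :: "real \<Rightarrow> nat \<Rightarrow> nat \<Rightarrow> real" where
  "grid T n i = real i * (T / real n)"

lemma grid_nonneg: "T > 0 \<Longrightarrow> grid T n i \<ge> 0"
  by (simp add: grid_def)

lemma grid_diff: "i \<ge> 1 \<Longrightarrow> grid T n i - grid T n (i - 1) = T / real n"
  by (cases i) (simp_all add: grid_def distrib_right del: times_divide_eq_right)

lemma grid_mono: "T > 0 \<Longrightarrow> i \<le> j \<Longrightarrow> grid T n i \<le> grid T n j"
  by (simp add: grid_def mult_right_mono divide_right_mono)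

text \<open>In contrast to \<open>realized_cov\<close>, it takes scalar processes in continuous time
  and is not divided by \<open>T\<close>, so it applies equally to the latent noises and to the
  observations.\<close>

definition realized_covar ::
  "real \<Rightarrow> (real \<Rightarrow> 'a \<Rightarrow> real) \<Rightarrow> (real \<Rightarrow> 'a \<Rightarrow> real) \<Rightarrow> nat \<Rightarrow> 'a \<Rightarrow> real" where
  "realized_covar T Y Z n \<omega> = (\<Sum>i = 1..n.
     (Y (grid T n i) \<omega> - Y (grid T n (i - 1)) \<omega>) * (Z (grid T n i) \<omega> - Z (grid T n (i - 1)) \<omega>))"

lemma realized_covar_measurable:
  assumes "T > 0" "\<And>t. t \<ge> 0 \<Longrightarrow> Y t \<in> borel_measurable P" "\<And>t. t \<ge> 0 \<Longrightarrow> Z t \<in> borel_measurable P"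
  shows "realized_covar T Y Z n \<in> borel_measurable P"
  unfolding realized_covar_def
  by (intro borel_measurable_sum borel_measurable_times borel_measurable_diff assms grid_nonneg)

lemma realized_covar_commute: "realized_covar T Y Z n \<omega> = realized_covar T Z Y n \<omega>"
  by (simp add: realized_covar_def mult.commute)

locale wiener = prob_space P for P :: "'a measure" +
  fixes F :: "real \<Rightarrow> 'a measure" and W :: "real \<Rightarrow> 'a \<Rightarrow> real^'r::finite"
  assumes basis: "usual_stochastic_basis P F" and wiener: "wiener_process P F W"
begin

lemma filtration_subalgebra: "t \<ge> 0 \<Longrightarrow> subalgebra P (F t)"
  using basis by (simp add: usual_stochastic_basis_def)

lemma filtration_measurable: "t \<ge> 0 \<Longrightarrow> f \<in> borel_measurable (F t) \<Longrightarrow> f \<in> borel_measurable P"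
  using measurable_from_subalg[OF filtration_subalgebra] .

lemma filtration_mono: 
  assumes "0 \<le> s" "s \<le> t" "f \<in> borel_measurable (F s)"
  shows "f \<in> borel_measurable (F t)"
proof -
  have "subalgebra (F t) (F s)"
  proof -
    have "sets (F s) \<subseteq> sets (F t)"
      using basis assms(1,2) unfolding usual_stochastic_basis_def by blast
    then show ?thesis
      using filtration_subalgebra[of s] filtration_subalgebra[of t] assms(1,2)
      by (simp add: subalgebra_def)
  qed
  then show ?thesis using assms(3) by (rule measurable_from_subalg)
qed

lemma adapted_wiener: "t \<ge> 0 \<Longrightarrow> W t \<in> borel_measurable (F t)"
  using wiener by (auto simp: wiener_process_def adapted_def)

lemma wiener_measurable [measurable]: "t \<ge> 0 \<Longrightarrow> W t \<in> borel_measurable P"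
  by (rule filtration_measurable[OF _ adapted_wiener])

lemma wiener_increment_distributed:
  assumes "0 \<le> s" "s < t"
  shows "distributed P lborel (\<lambda>\<omega>. W t \<omega> - W s \<omega>)
     (\<lambda>x. ennreal (\<Prod>i\<in>UNIV. normal_density 0 (sqrt (t - s)) (x $ i)))"
  using wiener assms by (auto simp: wiener_process_def)

text \<open>The sigma-algebras generated by the two variables lie inside \<open>F s\<close> and
  inside the one generated by the increment, and these are independent.\<close>

lemma wiener_increment_indep:
  assumes st: "0 \<le> s" "s < t" and Z: "Z \<in> borel_measurable (F s)" and g: "g \<in> borel_measurable borel"
  shows "indep_var borel Z borel (\<lambda>\<omega>. g (W t \<omega> - W s \<omega>))"
proof -
  let ?V = "vimage_algebra (space P) (\<lambda>\<omega>. W t \<omega> - W s \<omega>) borel"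
  have ind: "indep_set (sets (F s)) (sets ?V)"
    using wiener st by (auto simp: wiener_process_def)
  have spF: "space (F s) = space P"
    using filtration_subalgebra[OF st(1)] by (simp add: subalgebra_def)
  have "(\<lambda>\<omega>. W t \<omega> - W s \<omega>) \<in> measurable ?V borel"
    by (rule measurable_vimage_algebra1) auto
  then have gV: "(\<lambda>\<omega>. g (W t \<omega> - W s \<omega>)) \<in> borel_measurable ?V"
    using g by (rule measurable_compose)
  have "sigma_sets (space P) {Z -` A \<inter> space P |A. A \<in> sets borel} \<subseteq> sets (F s)"
    using measurable_sets[OF Z] unfolding spF[symmetric] by (intro sets.sigma_sets_subset) auto
  moreover have "sigma_sets (space P) {(\<lambda>\<omega>. g (W t \<omega> - W s \<omega>)) -` A \<inter> space P |A. A \<in> sets borel} \<subseteq> sets ?V"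
    using measurable_sets[OF gV] sets.sigma_sets_subset[of "{(\<lambda>\<omega>. g (W t \<omega> - W s \<omega>)) -` A \<inter> space P |A. A \<in> sets borel}" ?V]
    by (auto simp: space_vimage_algebra)
  ultimately have "indep_set (sigma_sets (space P) {Z -` A \<inter> space P |A. A \<in> sets borel})
      (sigma_sets (space P) {(\<lambda>\<omega>. g (W t \<omega> - W s \<omega>)) -` A \<inter> space P |A. A \<in> sets borel})"
    using ind unfolding indep_sets2_eq by blast
  moreover have "(\<lambda>\<omega>. g (W t \<omega> - W s \<omega>)) \<in> borel_measurable P"
    using st by (intro measurable_compose[OF _ g] borel_measurable_diff wiener_measurable) auto
  ultimately show ?thesis
    unfolding indep_var_eq using filtration_measurable[OF st(1) Z] by auto
qed

end

locale wiener_grid = wiener P F W for P :: "'a measure" and F and W :: "real \<Rightarrow> 'a \<Rightarrow> real^'r::finite" +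
  fixes T :: real and n :: nat
  assumes T_pos: "T > 0" and n_pos: "n \<ge> 1"
begin

definition dW :: "nat \<Rightarrow> 'a \<Rightarrow> real^'r" where
  "dW i \<omega> = W (grid T n i) \<omega> - W (grid T n (i - 1)) \<omega>"

lemma step_pos: "T / real n > 0"
  using T_pos n_pos by simp

lemma grid_less: "i \<ge> 1 \<Longrightarrow> grid T n (i - 1) < grid T n i"
  using grid_diff[of i T n] step_pos by simp

lemma dW_distributed:
  assumes "i \<ge> 1"
  shows "distributed P lborel (dW i)
     (\<lambda>x. ennreal (\<Prod>i\<in>UNIV. normal_density 0 (sqrt (T / real n)) (x $ i)))"
  using wiener_increment_distributed[OF grid_nonneg[OF T_pos] grid_less[OF assms]] grid_diff[OF assms, of T n]
  by (simp add: dW_def[abs_def])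

lemma dW_adapted: "1 \<le> i \<Longrightarrow> i \<le> j \<Longrightarrow> dW i \<in> borel_measurable (F (grid T n j))"
  unfolding dW_def[abs_def]
  by (intro borel_measurable_diff filtration_mono[OF _ _ adapted_wiener] grid_nonneg[OF T_pos] grid_mono[OF T_pos]) auto

text \<open>The earlier increment is already measurable at the grid point \<open>j - 1\<close>,
  where the later one starts.\<close>

lemma dW_indep:
  assumes ij: "1 \<le> i" "i < j" and f: "f \<in> borel_measurable borel" and g: "g \<in> borel_measurable borel"
  shows "indep_var borel (\<lambda>\<omega>. f (dW i \<omega>)) borel (\<lambda>\<omega>. g (dW j \<omega>))"
proof -
  have "(\<lambda>\<omega>. f (dW i \<omega>)) \<in> borel_measurable (F (grid T n (j - 1)))"
    using dW_adapted[of i "j - 1"] ij by (intro measurable_compose[OF _ f]) auto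
  from wiener_increment_indep[OF grid_nonneg[OF T_pos] grid_less this g] ij
  show ?thesis by (simp add: dW_def[abs_def])
qed

lemma sqrt_step: "sqrt (T / real n) > 0"
  using step_pos by simp

lemmas dW_moments = 
  integrable_gaussian_component[OF dW_distributed sqrt_step]
  expectation_gaussian_component[OF dW_distributed sqrt_step]
  integrable_gaussian_mult[OF dW_distributed sqrt_step]
  expectation_gaussian_mult[OF dW_distributed sqrt_step]
  integrable_gaussian_mult_sq[OF dW_distributed sqrt_step]
  expectation_gaussian_mult_sq[OF dW_distributed sqrt_step]

lemma
  assumes "1 \<le> i" "1 \<le> j"
  shows integrable_dW_mult: "integrable P (\<lambda>\<omega>. dW i \<omega> $ a * dW j \<omega> $ a)"
    and expectation_dW_mult: "expectation (\<lambda>\<omega>. dW i \<omega> $ a * dW j \<omega> $ a) = (if i = j then T / real n else 0)"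
proof -
  have *: "integrable P (\<lambda>\<omega>. dW i \<omega> $ a * dW j \<omega> $ a) \<and> expectation (\<lambda>\<omega>. dW i \<omega> $ a * dW j \<omega> $ a) = 0"
    if ij: "1 \<le> i" "i < j" for i j
  proof -
    have ind: "indep_var borel (\<lambda>\<omega>. dW i \<omega> $ a) borel (\<lambda>\<omega>. dW j \<omega> $ a)"
      by (rule dW_indep[OF ij]) auto
    have int: "integrable P (\<lambda>\<omega>. dW i \<omega> $ a)" "integrable P (\<lambda>\<omega>. dW j \<omega> $ a)"
      using dW_moments(1) ij by auto
    show ?thesis
      using indep_var_integrable[OF ind int] indep_var_lebesgue_integral[OF ind int] dW_moments(2)[of i a] ij by simp
  qed
  consider "i < j" | "i = j" | "j < i" by linarith
  then have "integrable P (\<lambda>\<omega>. dW i \<omega> $ a * dW j \<omega> $ a) \<and>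
      expectation (\<lambda>\<omega>. dW i \<omega> $ a * dW j \<omega> $ a) = (if i = j then T / real n else 0)"
  proof cases
    case 1
    then show ?thesis using *[of i j] assms by simp
  next
    case 2
    then show ?thesis using dW_moments(3,4)[of i a a] assms step_pos by simp
  next
    case 3
    then show ?thesis using *[of j i] assms by (simp add: mult.commute)
  qed
  then show "integrable P (\<lambda>\<omega>. dW i \<omega> $ a * dW j \<omega> $ a)"
    "expectation (\<lambda>\<omega>. dW i \<omega> $ a * dW j \<omega> $ a) = (if i = j then T / real n else 0)" by auto
qed

lemma realized_covar_eq_dW:
  "realized_covar T (\<lambda>t \<omega>. W t \<omega> $ a) (\<lambda>t \<omega>. W t \<omega> $ b) n \<omega> = (\<Sum>i = 1..n. dW i \<omega> $ a * dW i \<omega> $ b)"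
  by (simp add: realized_covar_def dW_def)

text \<open>After centring, the products of increments are uncorrelated, with second moment at most
  \<open>3 * (T / real n)\<^sup>2\<close> each; summing \<open>n\<close> of them gives the rate
  1/n.\<close>

lemma
  shows integrable_realized_covar_error_sq:
    "integrable P (\<lambda>\<omega>. (realized_covar T (\<lambda>t \<omega>. W t \<omega> $ a) (\<lambda>t \<omega>. W t \<omega> $ b) n \<omega> - (if a = b then T else 0))\<^sup>2)"
    and expectation_realized_covar_error_sq:
    "expectation (\<lambda>\<omega>. (realized_covar T (\<lambda>t \<omega>. W t \<omega> $ a) (\<lambda>t \<omega>. W t \<omega> $ b) n \<omega> - (if a = b then T else 0))\<^sup>2)
      \<le> 3 * T\<^sup>2 / real n"
proof -
  \<comment> \<open>The mean of one product of increments; \<open>n\<close> copies of it add up to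
    the limit \<open>T\<close> or 0.\<close>
  define c where "c = (if a = b then T / real n else 0)"
  define f where "f v = v $ a * v $ b - c" for v :: "real^'r"
  define Z where "Z i \<omega> = f (dW i \<omega>)" for i \<omega>
  have f [measurable]: "f \<in> borel_measurable borel" unfolding f_def[abs_def] by measurable
  have eq: "realized_covar T (\<lambda>t \<omega>. W t \<omega> $ a) (\<lambda>t \<omega>. W t \<omega> $ b) n \<omega> - (if a = b then T else 0) = (\<Sum>i = 1..n. Z i \<omega>)" for \<omega>
    using n_pos by (simp add: realized_covar_eq_dW Z_def f_def sum_subtractf c_def)
  have intZ: "integrable P (Z i)" if "1 \<le> i" for i
    unfolding Z_def[abs_def] f_def using dW_moments(3)[OF that] by simp
  have EZ: "expectation (Z i) = 0" if "1 \<le> i" for i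
    unfolding Z_def[abs_def] f_def c_def using dW_moments(3,4)[OF that, of a b] step_pos by (simp add: prob_space)
  have ZZ: "Z i \<omega> * Z i \<omega> = (dW i \<omega> $ a * dW i \<omega> $ b)\<^sup>2 - 2 * c * (dW i \<omega> $ a * dW i \<omega> $ b) + c\<^sup>2" for i \<omega>
    by (simp add: Z_def f_def power2_eq_square algebra_simps)
  have intZZ: "integrable P (\<lambda>\<omega>. Z i \<omega> * Z i \<omega>)" if "1 \<le> i" for i
    unfolding ZZ using dW_moments(3,5)[OF that, of a b] by simp
  have EZZ: "expectation (\<lambda>\<omega>. Z i \<omega> * Z i \<omega>) \<le> 3 * (T / real n)\<^sup>2" if "1 \<le> i" for i
  proof -
    have Ec: "expectation (\<lambda>\<omega>. dW i \<omega> $ a * dW i \<omega> $ b) = c"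
      using dW_moments(4)[OF that, of a b] step_pos by (simp add: c_def)
    have "expectation (\<lambda>\<omega>. Z i \<omega> * Z i \<omega>) = expectation (\<lambda>\<omega>. (dW i \<omega> $ a * dW i \<omega> $ b)\<^sup>2) - 2 * c * c + c\<^sup>2"
      unfolding ZZ using dW_moments(3,5)[OF that, of a b] by (simp add: prob_space Ec)
    also have "\<dots> \<le> expectation (\<lambda>\<omega>. (dW i \<omega> $ a * dW i \<omega> $ b)\<^sup>2)"
      by (simp add: power2_eq_square)
    also have "\<dots> \<le> 3 * sqrt (T / real n) ^ 4"
      using dW_moments(6)[OF that] .
    also have "sqrt (T / real n) ^ 4 = (T / real n)\<^sup>2"
      using step_pos power_mult[of "sqrt (T / real n)" 2 2] by simp
    finally show ?thesis .
  qed
  have indep: "integrable P (\<lambda>\<omega>. Z i \<omega> * Z j \<omega>) \<and> expectation (\<lambda>\<omega>. Z i \<omega> * Z j \<omega>) = 0" if "1 \<le> i" "i < j" for i j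
  proof -
    have ind: "indep_var borel (Z i) borel (Z j)"
      using dW_indep[OF that f f] by (simp add: Z_def[abs_def])
    show ?thesis
      using indep_var_integrable[OF ind intZ intZ] indep_var_lebesgue_integral[OF ind intZ intZ] EZ that by simp
  qed
  have int2: "integrable P (\<lambda>\<omega>. Z i \<omega> * Z j \<omega>)" if "1 \<le> i" "1 \<le> j" for i j
    using indep[of i j] indep[of j i] intZZ[of i] that
    by (cases i j rule: linorder_cases) (auto simp: mult.commute)
  have unc: "expectation (\<lambda>\<omega>. Z i \<omega> * Z j \<omega>) = 0" if "1 \<le> i" "1 \<le> j" "i \<noteq> j" for i j
    using indep[of i j] indep[of j i] that
    by (cases i j rule: linorder_cases) (auto simp: mult.commute)
  show "integrable P (\<lambda>\<omega>. (realized_covar T (\<lambda>t \<omega>. W t \<omega> $ a) (\<lambda>t \<omega>. W t \<omega> $ b) n \<omega> - (if a = b then T else 0))\<^sup>2)"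
    unfolding eq by (rule second_moment_sum_uncorrelated(1)[where c = "3 * (T / real n)\<^sup>2"]) (use int2 unc EZZ in auto)
  have "expectation (\<lambda>\<omega>. (\<Sum>i = 1..n. Z i \<omega>)\<^sup>2) \<le> real (card {1..n}) * (3 * (T / real n)\<^sup>2)"
    by (rule second_moment_sum_uncorrelated(2)) (use int2 unc EZZ in auto)
  also have "\<dots> = 3 * T\<^sup>2 / real n" by (simp add: power2_eq_square)
  finally show "expectation (\<lambda>\<omega>. (realized_covar T (\<lambda>t \<omega>. W t \<omega> $ a) (\<lambda>t \<omega>. W t \<omega> $ b) n \<omega> - (if a = b then T else 0))\<^sup>2)
      \<le> 3 * T\<^sup>2 / real n"
    unfolding eq .
qed

end

lemma (in wiener) null_in_prob_realized_covar:
  assumes "T > 0"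
  shows "null_in_prob P (\<lambda>n \<omega>. realized_covar T (\<lambda>t \<omega>. W t \<omega> $ a) (\<lambda>t \<omega>. W t \<omega> $ b) n \<omega> - (if a = b then T else 0))"
proof (rule null_in_prob_L2)
  fix n
  show "(\<lambda>\<omega>. realized_covar T (\<lambda>t \<omega>. W t \<omega> $ a) (\<lambda>t \<omega>. W t \<omega> $ b) n \<omega> - (if a = b then T else 0)) \<in> borel_measurable P"
    by (intro borel_measurable_diff realized_covar_measurable[OF assms] borel_measurable_const
        borel_measurable_component wiener_measurable)
  assume "1 \<le> n"
  then interpret wiener_grid P F W T n by unfold_locales (use assms in auto)
  show "integrable P (\<lambda>\<omega>. (realized_covar T (\<lambda>t \<omega>. W t \<omega> $ a) (\<lambda>t \<omega>. W t \<omega> $ b) n \<omega> - (if a = b then T else 0))\<^sup>2)"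
    by (rule integrable_realized_covar_error_sq)
  show "expectation (\<lambda>\<omega>. (realized_covar T (\<lambda>t \<omega>. W t \<omega> $ a) (\<lambda>t \<omega>. W t \<omega> $ b) n \<omega> - (if a = b then T else 0))\<^sup>2)
      \<le> 3 * T\<^sup>2 / real n"
    by (rule expectation_realized_covar_error_sq)
qed

text \<open>\<open>history P W\<close> is a bare family of sets; the measure space built from the
  same generators makes the usual measurability rules available for it.\<close>

lemma history_measurable:
  fixes W :: "real \<Rightarrow> 'a \<Rightarrow> real^'n"
  assumes "t \<ge> 0"
  shows "W t \<in> borel_measurable (sigma (space P) {W t -` A \<inter> space P | t A. 0 \<le> t \<and> A \<in> sets borel})"
proof (rule measurableI)
  fix A :: "(real^'n) set" assume "A \<in> sets borel"
  then show "W t -` A \<inter> space (sigma (space P) {W t -` A \<inter> space P | t A. 0 \<le> t \<and> A \<in> sets borel})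
      \<in> sets (sigma (space P) {W t -` A \<inter> space P | t A. 0 \<le> t \<and> A \<in> sets borel})"
    using assms unfolding space_measure_of_conv by (intro in_measure_of) auto
qed simp

lemma (in prob_space) indep_var_history:
  fixes U :: "real \<Rightarrow> 'a \<Rightarrow> real^'m::finite" and V :: "real \<Rightarrow> 'a \<Rightarrow> real^'n::finite"
  assumes ind: "indep_set (history M U) (history M V)"
    and A: "A \<in> borel_measurable (sigma (space M) {U t -` A \<inter> space M | t A. 0 \<le> t \<and> A \<in> sets borel})" (is "_ \<in> borel_measurable ?MU")
    and B: "B \<in> borel_measurable (sigma (space M) {V t -` A \<inter> space M | t A. 0 \<le> t \<and> A \<in> sets borel})" (is "_ \<in> borel_measurable ?MV")
  shows "indep_var borel (A :: 'a \<Rightarrow> real) borel (B :: 'a \<Rightarrow> real)"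
proof -
  have sets: "sets ?MU = history M U" "sets ?MV = history M V"
    unfolding history_def by (rule sets_measure_of; auto)+
  have sub: "history M U \<subseteq> events" "history M V \<subseteq> events"
    using ind by (auto simp: indep_sets2_eq)
  have AB: "random_variable borel A" "random_variable borel B"
    using measurable_from_subalg[OF _ A, of M] measurable_from_subalg[OF _ B, of M] sub
    by (auto simp: subalgebra_def sets space_measure_of_conv)
  have "sigma_sets (space M) {A -` S \<inter> space M |S. S \<in> sets borel} \<subseteq> history M U"
    using measurable_sets[OF A] sets.sigma_sets_subset[of "{A -` S \<inter> space M |S. S \<in> sets borel}" ?MU]
    unfolding sets space_measure_of_conv by auto
  moreover have "sigma_sets (space M) {B -` S \<inter> space M |S. S \<in> sets borel} \<subseteq> history M V"
    using measurable_sets[OF B] sets.sigma_sets_subset[of "{B -` S \<inter> space M |S. S \<in> sets borel}" ?MV]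
    unfolding sets space_measure_of_conv by auto
  ultimately show ?thesis
    unfolding indep_var_eq using AB ind unfolding indep_sets2_eq by blast
qed

text \<open>Independence of the histories factors the correlation of the \<open>i\<close>-th and
  \<open>j\<close>-th products into an increment covariance of \<open>U\<close> times one of
  \<open>V\<close>. Both vanish for distinct \<open>i\<close> and \<open>j\<close>, and both equal
  \<open>T / real n\<close> otherwise.\<close>

lemma (in prob_space) null_in_prob_realized_covar_indep:
  fixes U :: "real \<Rightarrow> 'a \<Rightarrow> real^'m::finite" and V :: "real \<Rightarrow> 'a \<Rightarrow> real^'n::finite"
  assumes T: "T > 0" and basis: "usual_stochastic_basis M F"
    and U: "wiener_process M F U" and V: "wiener_process M F V"
    and ind: "indep_set (history M U) (history M V)"
  shows "null_in_prob M (realized_covar T (\<lambda>t \<omega>. U t \<omega> $ a) (\<lambda>t \<omega>. V t \<omega> $ b))"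
proof -
  interpret U: wiener M F U by unfold_locales fact+
  interpret V: wiener M F V by unfold_locales fact+
  have mom: "integrable M (\<lambda>\<omega>. (realized_covar T (\<lambda>t \<omega>. U t \<omega> $ a) (\<lambda>t \<omega>. V t \<omega> $ b) n \<omega>)\<^sup>2) \<and>
      expectation (\<lambda>\<omega>. (realized_covar T (\<lambda>t \<omega>. U t \<omega> $ a) (\<lambda>t \<omega>. V t \<omega> $ b) n \<omega>)\<^sup>2) \<le> T\<^sup>2 / real n" if n: "n \<ge> 1" for n
  proof -
    interpret GU: wiener_grid M F U T n by unfold_locales fact+
    interpret GV: wiener_grid M F V T n by unfold_locales fact+
    define Z where "Z i \<omega> = GU.dW i \<omega> $ a * GV.dW i \<omega> $ b" for i \<omega>
    have eq: "realized_covar T (\<lambda>t \<omega>. U t \<omega> $ a) (\<lambda>t \<omega>. V t \<omega> $ b) n \<omega> = (\<Sum>i = 1..n. Z i \<omega>)" for \<omega>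
      by (simp add: realized_covar_def Z_def GU.dW_def GV.dW_def)
    have Z: "integrable M (\<lambda>\<omega>. Z i \<omega> * Z j \<omega>) \<and>
        expectation (\<lambda>\<omega>. Z i \<omega> * Z j \<omega>) = (if i = j then (T / real n)\<^sup>2 else 0)" if "1 \<le> i" "1 \<le> j" for i j
    proof -
      have ind': "indep_var borel (\<lambda>\<omega>. GU.dW i \<omega> $ a * GU.dW j \<omega> $ a) borel (\<lambda>\<omega>. GV.dW i \<omega> $ b * GV.dW j \<omega> $ b)"
        unfolding GU.dW_def GV.dW_def
        by (intro indep_var_history[OF ind] borel_measurable_times borel_measurable_component
            borel_measurable_diff history_measurable grid_nonneg[OF T])
      \<comment> \<open>Regrouped by process: the first factor depends on \<open>U\<close> alone,
        the second on \<open>V\<close> alone.\<close>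
      have e: "Z i \<omega> * Z j \<omega> = (GU.dW i \<omega> $ a * GU.dW j \<omega> $ a) * (GV.dW i \<omega> $ b * GV.dW j \<omega> $ b)" for \<omega>
        by (simp add: Z_def mult_ac)
      note int = GU.integrable_dW_mult[OF that, of a] GV.integrable_dW_mult[OF that, of b]
      show ?thesis
        unfolding e using indep_var_integrable[OF ind' int] indep_var_lebesgue_integral[OF ind' int]
          GU.expectation_dW_mult[OF that, of a] GV.expectation_dW_mult[OF that, of b]
        by (simp add: power2_eq_square)
    qed
    have "integrable M (\<lambda>\<omega>. (\<Sum>i = 1..n. Z i \<omega>)\<^sup>2)"
      by (rule second_moment_sum_uncorrelated(1)[where c = "(T / real n)\<^sup>2"]) (use Z in auto)
    moreover have "expectation (\<lambda>\<omega>. (\<Sum>i = 1..n. Z i \<omega>)\<^sup>2) \<le> real (card {1..n}) * (T / real n)\<^sup>2"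
      by (rule second_moment_sum_uncorrelated(2)) (use Z in auto)
    moreover have "real (card {1..n}) * (T / real n)\<^sup>2 = T\<^sup>2 / real n"
      by (simp add: power2_eq_square)
    ultimately show ?thesis unfolding eq by simp
  qed
  show ?thesis
    by (rule null_in_prob_L2[where C = "T\<^sup>2"])
      (use mom in \<open>auto intro!: realized_covar_measurable[OF T] borel_measurable_component
        U.wiener_measurable V.wiener_measurable\<close>)
qed

section \<open>Realized covariation of the observable process\<close>

lemma block_vec_nth [simp]: "block_vec u v $ Inl a = u $ a" "block_vec u v $ Inr b = v $ b"
  by (simp_all add: block_vec_def)

lemma inner_block_vec: "block_vec u v \<bullet> block_vec u' v' = u \<bullet> u' + v \<bullet> v'"
  by (simp add: inner_vec_def UNIV_Plus_UNIV[symmetric] sum.Plus del: UNIV_Plus_UNIV)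

text \<open>The quadratic covariation at time \<open>T\<close> of a standard Wiener process, as a
  limit in probability. Noises are concatenated at the level of these limits, where pairwise
  statements about coordinates suffice, and not as Wiener processes.\<close>

definition unit_covariation :: "'a measure \<Rightarrow> real \<Rightarrow> (real \<Rightarrow> 'a \<Rightarrow> real^'n) \<Rightarrow> bool" where
  "unit_covariation P T w \<longleftrightarrow> (\<forall>a b. null_in_prob P
     (\<lambda>n \<omega>. realized_covar T (\<lambda>t \<omega>. w t \<omega> $ a) (\<lambda>t \<omega>. w t \<omega> $ b) n \<omega> - (if a = b then T else 0)))"

definition zero_covariation ::
  "'a measure \<Rightarrow> real \<Rightarrow> (real \<Rightarrow> 'a \<Rightarrow> real^'m) \<Rightarrow> (real \<Rightarrow> 'a \<Rightarrow> real^'n) \<Rightarrow> bool" where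
  "zero_covariation P T u v \<longleftrightarrow> (\<forall>a b. null_in_prob P
     (realized_covar T (\<lambda>t \<omega>. u t \<omega> $ a) (\<lambda>t \<omega>. v t \<omega> $ b)))"

lemma unit_covariation_block_vec:
  assumes "unit_covariation P T u" "unit_covariation P T v" "zero_covariation P T u v"
  shows "unit_covariation P T (\<lambda>t \<omega>. block_vec (u t \<omega>) (v t \<omega>))"
  unfolding unit_covariation_def
proof (intro allI)
  fix a b :: "'b + 'c"
  have comm: "realized_covar T (\<lambda>t \<omega>. v t \<omega> $ j) (\<lambda>t \<omega>. u t \<omega> $ i) =
      realized_covar T (\<lambda>t \<omega>. u t \<omega> $ i) (\<lambda>t \<omega>. v t \<omega> $ j)" for i j
    by (intro ext realized_covar_commute)
  show "null_in_prob P (\<lambda>n \<omega>. realized_covar T (\<lambda>t \<omega>. block_vec (u t \<omega>) (v t \<omega>) $ a)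
      (\<lambda>t \<omega>. block_vec (u t \<omega>) (v t \<omega>) $ b) n \<omega> - (if a = b then T else 0))"
    using assms unfolding unit_covariation_def zero_covariation_def
    by (cases a; cases b) (simp_all add: comm)
qed

lemma zero_covariation_block_vec:
  assumes "zero_covariation P T u v" "zero_covariation P T u w"
  shows "zero_covariation P T u (\<lambda>t \<omega>. block_vec (v t \<omega>) (w t \<omega>))"
  unfolding zero_covariation_def
proof (intro allI)
  fix a and b :: "'c + 'd"
  show "null_in_prob P (realized_covar T (\<lambda>t \<omega>. u t \<omega> $ a) (\<lambda>t \<omega>. block_vec (v t \<omega>) (w t \<omega>) $ b))"
    using assms unfolding zero_covariation_def by (cases b) simp_all
qed

text \<open>Realized covariation is bilinear, so the error is a finite linear combination of the
  coordinatewise errors \<open>Q\<close>.\<close>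

lemma (in prob_space) null_in_prob_realized_covar_inner:
  fixes w :: "real \<Rightarrow> 'a \<Rightarrow> real^'n"
  assumes "unit_covariation M T w"
  shows "null_in_prob M (\<lambda>n \<omega>. realized_covar T (\<lambda>t \<omega>. x \<bullet> w t \<omega>) (\<lambda>t \<omega>. y \<bullet> w t \<omega>) n \<omega> - T * (x \<bullet> y))"
proof -
  define Q where "Q r s n \<omega> = realized_covar T (\<lambda>t \<omega>. w t \<omega> $ r) (\<lambda>t \<omega>. w t \<omega> $ s) n \<omega> - (if r = s then T else 0)"
    for r s n \<omega>
  have "realized_covar T (\<lambda>t \<omega>. x \<bullet> w t \<omega>) (\<lambda>t \<omega>. y \<bullet> w t \<omega>) n \<omega> - T * (x \<bullet> y) =
      (\<Sum>r\<in>UNIV. \<Sum>s\<in>UNIV. x $ r * y $ s * Q r s n \<omega>)" for n \<omega>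
  proof -
    have "realized_covar T (\<lambda>t \<omega>. x \<bullet> w t \<omega>) (\<lambda>t \<omega>. y \<bullet> w t \<omega>) n \<omega> =
      (\<Sum>i = 1..n. \<Sum>r\<in>UNIV. \<Sum>s\<in>UNIV. x $ r * y $ s *
        ((w (grid T n i) \<omega> $ r - w (grid T n (i - 1)) \<omega> $ r) * (w (grid T n i) \<omega> $ s - w (grid T n (i - 1)) \<omega> $ s)))"
      unfolding realized_covar_def inner_diff_right[symmetric]
      by (intro sum.cong refl) (simp add: inner_vec_def sum_product mult_ac)
    also have "\<dots> = (\<Sum>r\<in>UNIV. \<Sum>s\<in>UNIV. x $ r * y $ s * realized_covar T (\<lambda>t \<omega>. w t \<omega> $ r) (\<lambda>t \<omega>. w t \<omega> $ s) n \<omega>)"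
      unfolding realized_covar_def sum_distrib_left
      by (subst sum.swap, rule sum.cong[OF refl], rule sum.swap)
    moreover have "T * (x \<bullet> y) = (\<Sum>r\<in>UNIV. \<Sum>s\<in>UNIV. x $ r * y $ s * (if r = s then T else 0))"
    proof -
      have "(\<Sum>s\<in>UNIV. x $ r * y $ s * (if r = s then T else 0)) = (\<Sum>s\<in>UNIV. if s = r then T * (x $ r * y $ r) else 0)" for r
        by (rule sum.cong) auto
      then show ?thesis by (simp add: inner_vec_def sum_distrib_left)
    qed
    ultimately show ?thesis
      by (simp add: Q_def right_diff_distrib sum_subtractf)
  qed
  moreover have "null_in_prob M (\<lambda>n \<omega>. \<Sum>r\<in>UNIV. \<Sum>s\<in>UNIV. x $ r * y $ s * Q r s n \<omega>)"
    using assms unfolding unit_covariation_def Q_def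
    by (intro null_in_prob_sum null_in_prob_cmult) auto
  ultimately show ?thesis by simp
qed

section \<open>Pathwise estimates for the drift\<close>

lemma grid_le: "T > 0 \<Longrightarrow> i \<le> n \<Longrightarrow> grid T n i \<le> T"
  by (cases "n = 0") (auto simp: grid_def field_simps mult_right_mono)

lemma grid_in: "T > 0 \<Longrightarrow> i \<in> {1..n} \<Longrightarrow> grid T n i \<in> {0..T} \<and> grid T n (i - 1) \<in> {0..T}"
  using grid_nonneg[of T n] grid_le[of T] by auto

text \<open>On a fine grid the increments of \<open>y\<close> are uniformly small, while the
  absolute increments of \<open>d\<close> add up to at most \<open>K * T\<close>.\<close>

lemma continuous_lipschitz_covariation_tendsto_0:
  fixes y d :: "real \<Rightarrow> real"
  assumes T: "T > 0" and y: "continuous_on {0..T} y" and d: "K-lipschitz_on {0..T} d"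
  shows "(\<lambda>n. \<Sum>i = 1..n. (y (grid T n i) - y (grid T n (i - 1))) * (d (grid T n i) - d (grid T n (i - 1)))) \<longlonglongrightarrow> 0"
proof (rule LIMSEQ_I)
  fix e :: real assume e: "e > 0"
  have K: "K \<ge> 0" using d lipschitz_on_nonneg by blast
  \<comment> \<open>The added 1 keeps the denominator positive and makes the final estimate
    strict.\<close>
  define e' where "e' = e / (K * T + 1)"
  have KT: "K * T + 1 > 0" using K T by (simp add: add_nonneg_pos)
  have e': "e' > 0" using e KT by (simp add: e'_def)
  obtain \<delta> where \<delta>: "\<delta> > 0" "\<And>s t. s \<in> {0..T} \<Longrightarrow> t \<in> {0..T} \<Longrightarrow> dist s t < \<delta> \<Longrightarrow> dist (y s) (y t) < e'"
    using compact_uniformly_continuous[OF y compact_Icc] e' unfolding uniformly_continuous_on_def by metis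
  obtain N where N: "real N > T / \<delta>" using reals_Archimedean2 by blast
  show "\<exists>N. \<forall>n\<ge>N. norm ((\<Sum>i = 1..n. (y (grid T n i) - y (grid T n (i - 1))) * (d (grid T n i) - d (grid T n (i - 1)))) - 0) < e"
  proof (intro exI[of _ "Suc N"] allI impI)
    fix n assume n: "Suc N \<le> n"
    have h: "T / real n < \<delta>"
    proof -
      have "T / \<delta> < real n" using N n by linarith
      then show ?thesis using \<delta>(1) n by (simp add: divide_less_eq mult.commute)
    qed
    have summand_le: "\<bar>(y (grid T n i) - y (grid T n (i - 1))) * (d (grid T n i) - d (grid T n (i - 1)))\<bar> \<le> e' * (K * (T / real n))"
      if i: "i \<in> {1..n}" for i
    proof -
      have g: "dist (grid T n i) (grid T n (i - 1)) = T / real n"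
        using grid_diff[of i T n] i T by (simp add: dist_real_def)
      have "\<bar>y (grid T n i) - y (grid T n (i - 1))\<bar> \<le> e'"
        using \<delta>(2)[of "grid T n i" "grid T n (i - 1)"] grid_in[OF T i] g h by (simp add: dist_real_def)
      moreover have "\<bar>d (grid T n i) - d (grid T n (i - 1))\<bar> \<le> K * (T / real n)"
        using lipschitz_onD[OF d, of "grid T n i" "grid T n (i - 1)"] grid_in[OF T i] g by (simp add: dist_real_def)
      ultimately show ?thesis
        using e' by (simp only: abs_mult) (intro mult_mono, auto)
    qed
    have "\<bar>\<Sum>i = 1..n. (y (grid T n i) - y (grid T n (i - 1))) * (d (grid T n i) - d (grid T n (i - 1)))\<bar> \<le> (\<Sum>i = 1..n. e' * (K * (T / real n)))"
      using summand_le by (intro order.trans[OF sum_abs] sum_mono) blast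
    also have "\<dots> = e' * (K * T)" using n by simp
    also have "\<dots> < e' * (K * T + 1)" using e' by simp
    also have "\<dots> = e" using KT by (simp add: e'_def)
    finally show "norm ((\<Sum>i = 1..n. (y (grid T n i) - y (grid T n (i - 1))) * (d (grid T n i) - d (grid T n (i - 1)))) - 0) < e"
      by simp
  qed
qed

text \<open>The difference of the products of increments is split into two sums, each pairing a
  continuous path with a Lipschitz one: \<open>ma\<close> with \<open>db\<close>, and the full path
  \<open>mb + db\<close> with \<open>da\<close>. Keeping the full path in the second sum absorbs the
  product of the two drift increments.\<close>

lemma realized_covar_lipschitz_perturbation:
  assumes T: "T > 0"
    and ma: "continuous_on {0..T} (\<lambda>t. ma t \<omega>)" and mb: "continuous_on {0..T} (\<lambda>t. mb t \<omega>)"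
    and da: "Ka-lipschitz_on {0..T} da" and db: "Kb-lipschitz_on {0..T} db"
    and xa: "\<And>t. t \<in> {0..T} \<Longrightarrow> xa t \<omega> = ma t \<omega> + da t"
    and xb: "\<And>t. t \<in> {0..T} \<Longrightarrow> xb t \<omega> = mb t \<omega> + db t"
  shows "(\<lambda>n. realized_covar T xa xb n \<omega> - realized_covar T ma mb n \<omega>) \<longlonglongrightarrow> 0"
proof -
  have cb: "continuous_on {0..T} (\<lambda>t. mb t \<omega> + db t)"
    by (intro continuous_on_add mb lipschitz_on_continuous_on[OF db])
  have eq: "realized_covar T xa xb n \<omega> - realized_covar T ma mb n \<omega> =
     (\<Sum>i = 1..n. (ma (grid T n i) \<omega> - ma (grid T n (i - 1)) \<omega>) * (db (grid T n i) - db (grid T n (i - 1)))) +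
     (\<Sum>i = 1..n. ((mb (grid T n i) \<omega> + db (grid T n i)) - (mb (grid T n (i - 1)) \<omega> + db (grid T n (i - 1)))) *
       (da (grid T n i) - da (grid T n (i - 1))))" for n
    unfolding realized_covar_def sum_subtractf[symmetric] sum.distrib[symmetric]
  proof (rule sum.cong[OF refl])
    fix i assume i: "i \<in> {1..n}"
    show "(xa (grid T n i) \<omega> - xa (grid T n (i - 1)) \<omega>) * (xb (grid T n i) \<omega> - xb (grid T n (i - 1)) \<omega>) -
        (ma (grid T n i) \<omega> - ma (grid T n (i - 1)) \<omega>) * (mb (grid T n i) \<omega> - mb (grid T n (i - 1)) \<omega>) =
        (ma (grid T n i) \<omega> - ma (grid T n (i - 1)) \<omega>) * (db (grid T n i) - db (grid T n (i - 1))) +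
        ((mb (grid T n i) \<omega> + db (grid T n i)) - (mb (grid T n (i - 1)) \<omega> + db (grid T n (i - 1)))) *
        (da (grid T n i) - da (grid T n (i - 1)))"
      using xa[of "grid T n i"] xa[of "grid T n (i - 1)"] xb[of "grid T n i"] xb[of "grid T n (i - 1)"] grid_in[OF T i]
      by (simp add: algebra_simps)
  qed
  show ?thesis unfolding eq
    using tendsto_add[OF continuous_lipschitz_covariation_tendsto_0[OF T ma db]
        continuous_lipschitz_covariation_tendsto_0[OF T cb da]] by simp
qed

lemma indefinite_integral_lipschitz:
  fixes f :: "real \<Rightarrow> 'b::euclidean_space"
  assumes f: "continuous_on {0..T} f"
  obtains K where "K-lipschitz_on {0..T} (\<lambda>t. integral {0..t} f)"
proof -
  obtain K where K: "K > 0" "\<And>t. t \<in> {0..T} \<Longrightarrow> norm (f t) \<le> K"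
    using compact_imp_bounded[OF compact_continuous_image[OF f compact_Icc]] unfolding bounded_pos by auto
  have main: "norm (integral {0..t} f - integral {0..s} f) \<le> K * (t - s)" if "0 \<le> s" "s \<le> t" "t \<le> T" for s t
  proof -
    have "continuous_on {0..t} f" "continuous_on {s..t} f"
      using that by (auto intro: continuous_on_subset[OF f])
    then have "integral {0..s} f + integral {s..t} f = integral {0..t} f"
      using that by (intro Henstock_Kurzweil_Integration.integral_combine integrable_continuous_interval) auto
    then have "integral {0..t} f - integral {0..s} f = integral {s..t} f"
      by (metis add_diff_cancel_left')
    moreover have "norm (integral {s..t} f) \<le> K * (t - s)"
      using that K \<open>continuous_on {s..t} f\<close> by (intro integral_bound) auto
    ultimately show ?thesis by simp
  qed
  have "K-lipschitz_on {0..T} (\<lambda>t. integral {0..t} f)"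
  proof (rule lipschitz_onI)
    fix s t assume "s \<in> {0..T}" "t \<in> {0..T}"
    then show "dist (integral {0..s} f) (integral {0..t} f) \<le> K * dist s t"
      using main[of s t] main[of t s]
      by (cases "s \<le> t") (auto simp: dist_norm norm_minus_commute)
  qed (use K in simp)
  then show ?thesis by (rule that)
qed

text \<open>The noise is additive, so subtracting it leaves a constant plus the time integral of the
  drift along the path. That integrand is continuous, hence bounded on the compact interval, by a
  constant depending on the path.\<close>

lemma sde_solution_drift_lipschitz:
  fixes Y :: "real \<Rightarrow> 'a \<Rightarrow> real^'d" and W :: "real \<Rightarrow> 'a \<Rightarrow> real^'r"
  assumes sde: "sde_solution P F B S W c Y" and B: "continuous_on UNIV B"
  shows "AE \<omega> in P. \<exists>K D. K-lipschitz_on {0..T} D \<and> (\<forall>t\<in>{0..T}. Y t \<omega> = D t + S *v W t \<omega>)"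
proof -
  have "AE \<omega> in P. continuous_on {0..} (\<lambda>t. Y t \<omega>) \<and>
      (\<forall>t\<ge>0. Y t \<omega> = c + integral {0..t} (\<lambda>s. B (Y s \<omega>)) + S *v (W t \<omega> - W 0 \<omega>))"
    using sde by (simp add: sde_solution_def)
  then show ?thesis
  proof eventually_elim
    case (elim \<omega>)
    have "continuous_on {0..T} (\<lambda>s. B (Y s \<omega>))"
      using continuous_on_subset[OF conjunct1[OF elim], of "{0..T}"]
      by (intro continuous_on_compose2[OF B]) auto
    then obtain K where "K-lipschitz_on {0..T} (\<lambda>t. integral {0..t} (\<lambda>s. B (Y s \<omega>)))"
      by (rule indefinite_integral_lipschitz)
    then have "(0 + K)-lipschitz_on {0..T} (\<lambda>t. (c - S *v W 0 \<omega>) + integral {0..t} (\<lambda>s. B (Y s \<omega>)))"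
      by (intro lipschitz_on_add lipschitz_on_constant)
    moreover have "\<forall>t\<in>{0..T}. Y t \<omega> = (c - S *v W 0 \<omega>) + integral {0..t} (\<lambda>s. B (Y s \<omega>)) + S *v W t \<omega>"
      using elim by (auto simp: matrix_vector_mult_diff_distrib)
    ultimately show ?case by blast
  qed
qed

section \<open>Limit of the realized covariance of the observations\<close>

lemma (in prob_space) indep_sets_imp_indep_set:
  assumes ind: "indep_sets F I" and ij: "i \<in> I" "j \<in> I" "i \<noteq> j"
  shows "indep_set (F i) (F j)"
  unfolding indep_sets2_eq
proof (intro conjI ballI)
  show "F i \<subseteq> events" "F j \<subseteq> events"
    using ind ij by (auto simp: indep_sets_def)
  fix a b assume ab: "a \<in> F i" "b \<in> F j"
  have "prob (\<Inter>k\<in>{i, j}. if k = i then a else b) = (\<Prod>k\<in>{i, j}. prob (if k = i then a else b))"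
    by (rule indep_setsD[OF ind]) (use ij ab in auto)
  then show "prob (a \<inter> b) = prob a * prob b"
    using ij(3) by (simp add: Int_commute)
qed

text \<open>One row for the concatenation of all four noises, so that the four inner products in
  \<open>Sigma_mat_nth\<close> merge into one.\<close>

definition load_row :: "('p1::finite, 'p2::finite, 'k1::finite, 'k2::finite, 'r1::finite, 'r2::finite, 'r3::finite, 'r4::finite) sem_params
    \<Rightarrow> 'p1 + 'p2 \<Rightarrow> real^('r1 + 'r2 + 'r3 + 'r4)" where
  "load_row p a = block_vec (load1 p $ a) (block_vec (load2 p $ a) (block_vec (load3 p $ a) (load4 p $ a)))"

lemma Sigma_mat_nth_load_row: "Sigma_mat p $ a $ b = load_row p a \<bullet> load_row p b"
  by (simp add: Sigma_mat_nth load_row_def inner_block_vec)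

lemma lipschitz_on_matrix_component:
  fixes R :: "real^'n^'m" and D :: "real \<Rightarrow> real^'n"
  assumes "K-lipschitz_on U D"
  obtains L where "L-lipschitz_on U (\<lambda>t. (R *v D t) $ a)"
proof -
  have "bounded_linear (\<lambda>x. (R *v x) $ a)"
    using bounded_linear_compose[OF bounded_linear_vec_nth matrix_vector_mul_bounded_linear] .
  then obtain B where "B-lipschitz_on (D ` U) (\<lambda>x. (R *v x) $ a)"
    by (rule bounded_linear.lipschitz_boundE)
  from lipschitz_on_compose2[OF assms this] show ?thesis by (rule that)
qed

text \<open>Reduced form of the structural equation: inverting \<open>Psi p\<close> eliminates
  \<open>e\<close>, and the observation becomes linear in the four processes driven by the
  stochastic differential equations.\<close>

lemma sem_observable_linear:
  fixes p :: "('p1::finite, 'p2::finite, 'k1::finite, 'k2::finite, 'r1::finite, 'r2::finite, 'r3::finite, 'r4::finite) sem_params"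
  assumes Psi: "invertible (Psi p)" and eta: "e = Bmat p *v e + Gam p *v x + z"
  shows "block_vec (Lam1 p *v x + d) (Lam2 p *v e + u) =
    stack_rows (Lam1 p) (Lam2 p ** matrix_inv (Psi p) ** Gam p) *v x + stack_rows (mat 1) 0 *v d +
    stack_rows 0 (mat 1) *v u + stack_rows 0 (Lam2 p ** matrix_inv (Psi p)) *v z"
proof -
  have "Psi p *v e = Gam p *v x + z"
    using eta by (simp add: Psi_def matrix_vector_mult_diff_rdistrib algebra_simps)
  then have "matrix_inv (Psi p) *v (Psi p *v e) = matrix_inv (Psi p) *v (Gam p *v x + z)"
    by simp
  then have e: "e = matrix_inv (Psi p) *v (Gam p *v x) + matrix_inv (Psi p) *v z"
    by (simp add: matrix_vector_mul_assoc matrix_inv_mult_left[OF Psi] matrix_vector_right_distrib)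
  have "Lam2 p *v e = (Lam2 p ** matrix_inv (Psi p) ** Gam p) *v x + (Lam2 p ** matrix_inv (Psi p)) *v z"
    by (subst e) (simp add: matrix_vector_mul_assoc matrix_vector_right_distrib matrix_mul_assoc)
  then show ?thesis
    by (simp add: stack_rows_mult_vec block_vec_add add_ac)
qed

lemma matrix_vector_mult_component_inner: "(A *v x) $ i = (A :: real^'n^'m) $ i \<bullet> x"
  by (simp add: matrix_vector_mult_def inner_vec_def)

text \<open>The error splits into the effect of the drifts, which vanishes almost surely, and the
  error for linear images of the joint noise, which vanishes in probability.\<close>

lemma realized_cov_null_in_prob:
  fixes P :: "'a measure" and F :: "real \<Rightarrow> 'a measure"
    and W1 :: "real \<Rightarrow> 'a \<Rightarrow> real^'r1::finite"
    and W2 :: "real \<Rightarrow> 'a \<Rightarrow> real^'r2::finite"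
    and W3 :: "real \<Rightarrow> 'a \<Rightarrow> real^'r3::finite"
    and W4 :: "real \<Rightarrow> 'a \<Rightarrow> real^'r4::finite"
    and p :: "('p1::finite, 'p2::finite, 'k1::finite, 'k2::finite, 'r1, 'r2, 'r3, 'r4) sem_params"
    and X :: "real \<Rightarrow> 'a \<Rightarrow> real^('p1 + 'p2)"
  assumes basis: "usual_stochastic_basis P F"
    and wiener: "wiener_process P F W1" "wiener_process P F W2"
      "wiener_process P F W3" "wiener_process P F W4"
    and wiener_indep: "prob_space.indep_sets P
      (\<lambda>j. [history P W1, history P W2, history P W3, history P W4] ! j) {0..<4}"
    and Psi: "invertible (Psi p)"
    and sde: "sde_solution P F B1 (S1 p) W1 c1 \<xi>" "sde_solution P F B2 (S2 p) W2 c2 \<delta>"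
      "sde_solution P F B3 (S3 p) W3 c3 \<epsilon>" "sde_solution P F B4 (S4 p) W4 c4 \<zeta>"
    and drift: "continuous_on UNIV B1" "continuous_on UNIV B2"
      "continuous_on UNIV B3" "continuous_on UNIV B4"
    and eta: "\<And>t \<omega>. t \<ge> 0 \<Longrightarrow> \<omega> \<in> space P \<Longrightarrow>
      \<eta> t \<omega> = Bmat p *v \<eta> t \<omega> + Gam p *v \<xi> t \<omega> + \<zeta> t \<omega>"
    and obs: "\<And>t \<omega>. t \<ge> 0 \<Longrightarrow> \<omega> \<in> space P \<Longrightarrow>
      X t \<omega> = block_vec (Lam1 p *v \<xi> t \<omega> + \<delta> t \<omega>) (Lam2 p *v \<eta> t \<omega> + \<epsilon> t \<omega>)"
    and T: "T > 0"
  shows "null_in_prob P (\<lambda>n \<omega>. realized_cov T n (sample_vec T X n \<omega>) $ a $ b - Sigma_mat p $ a $ b)"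
proof -
  interpret prob_space P using basis by (simp add: usual_stochastic_basis_def)
  interpret W1: wiener P F W1 by unfold_locales fact+
  interpret W2: wiener P F W2 by unfold_locales fact+
  interpret W3: wiener P F W3 by unfold_locales fact+
  interpret W4: wiener P F W4 by unfold_locales fact+

  have ind: "indep_set (history P W1) (history P W2)" "indep_set (history P W1) (history P W3)"
    "indep_set (history P W1) (history P W4)" "indep_set (history P W2) (history P W3)"
    "indep_set (history P W2) (history P W4)" "indep_set (history P W3) (history P W4)"
    using indep_sets_imp_indep_set[OF wiener_indep, of 0 1] indep_sets_imp_indep_set[OF wiener_indep, of 0 2]
      indep_sets_imp_indep_set[OF wiener_indep, of 0 3] indep_sets_imp_indep_set[OF wiener_indep, of 1 2]
      indep_sets_imp_indep_set[OF wiener_indep, of 1 3] indep_sets_imp_indep_set[OF wiener_indep, of 2 3]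
    by (simp_all add: numeral_2_eq_2 numeral_3_eq_3)
  have unit: "unit_covariation P T W1" "unit_covariation P T W2" "unit_covariation P T W3" "unit_covariation P T W4"
    unfolding unit_covariation_def
    using W1.null_in_prob_realized_covar[OF T] W2.null_in_prob_realized_covar[OF T]
      W3.null_in_prob_realized_covar[OF T] W4.null_in_prob_realized_covar[OF T] by blast+
  have zero: "zero_covariation P T W1 W2" "zero_covariation P T W1 W3" "zero_covariation P T W1 W4"
    "zero_covariation P T W2 W3" "zero_covariation P T W2 W4" "zero_covariation P T W3 W4"
    unfolding zero_covariation_def
    using ind by (auto intro!: null_in_prob_realized_covar_indep[OF T basis] wiener)
  define w where "w t \<omega> = block_vec (W1 t \<omega>) (block_vec (W2 t \<omega>) (block_vec (W3 t \<omega>) (W4 t \<omega>)))" for t \<omega>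
  have "unit_covariation P T w"
    unfolding w_def[abs_def]
    by (intro unit_covariation_block_vec zero_covariation_block_vec unit zero)
  from null_in_prob_realized_covar_inner[OF this, of "load_row p a" "load_row p b"]
  have lim_w: "null_in_prob P (\<lambda>n \<omega>. realized_covar T (\<lambda>t \<omega>. load_row p a \<bullet> w t \<omega>) (\<lambda>t \<omega>. load_row p b \<bullet> w t \<omega>) n \<omega>
      - T * Sigma_mat p $ a $ b)"
    by (simp add: Sigma_mat_nth_load_row)

  \<comment> \<open>The loadings of \<open>X\<close> on the four latent processes; multiplied by the
    diffusion matrices they become the loadings on the noises.\<close>
  define R1 where "R1 = stack_rows (Lam1 p) (Lam2 p ** matrix_inv (Psi p) ** Gam p)"
  define R2 :: "real^'p1^('p1 + 'p2)" where "R2 = stack_rows (mat 1) 0"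
  define R3 :: "real^'p2^('p1 + 'p2)" where "R3 = stack_rows 0 (mat 1)"
  define R4 :: "real^'k2^('p1 + 'p2)" where "R4 = stack_rows 0 (Lam2 p ** matrix_inv (Psi p))"
  have load: "R1 ** S1 p = load1 p" "R2 ** S2 p = load2 p" "R3 ** S3 p = load3 p" "R4 ** S4 p = load4 p"
    by (simp_all add: R1_def R2_def R3_def R4_def load1_def load2_def load3_def load4_def stack_rows_mult)
  have X: "X t \<omega> = R1 *v \<xi> t \<omega> + R2 *v \<delta> t \<omega> + R3 *v \<epsilon> t \<omega> + R4 *v \<zeta> t \<omega>"
    if "t \<ge> 0" "\<omega> \<in> space P" for t \<omega>
    unfolding obs[OF that] R1_def R2_def R3_def R4_def
    by (rule sem_observable_linear[OF Psi eta[OF that]])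

  have X_meas: "(\<lambda>\<omega>. X t \<omega> $ i) \<in> borel_measurable P" if t: "t \<ge> 0" for t i
  proof -
    have "\<xi> t \<in> borel_measurable P" "\<delta> t \<in> borel_measurable P" "\<epsilon> t \<in> borel_measurable P" "\<zeta> t \<in> borel_measurable P"
      using sde t unfolding sde_solution_def adapted_def by (auto intro: W1.filtration_measurable)
    then have "(\<lambda>\<omega>. R1 $ i \<bullet> \<xi> t \<omega> + R2 $ i \<bullet> \<delta> t \<omega> + R3 $ i \<bullet> \<epsilon> t \<omega> + R4 $ i \<bullet> \<zeta> t \<omega>) \<in> borel_measurable P"
      by (intro borel_measurable_add borel_measurable_inner borel_measurable_const)
    then show ?thesis
      by (rule measurable_cong[THEN iffD1, rotated]) (simp add: X t matrix_vector_mult_component_inner)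
  qed
  have w_meas: "(\<lambda>\<omega>. load_row p i \<bullet> w t \<omega>) \<in> borel_measurable P" if t: "t \<ge> 0" for t i
    unfolding load_row_def w_def inner_block_vec
    using t by (intro borel_measurable_add borel_measurable_inner borel_measurable_const
      W1.wiener_measurable W2.wiener_measurable W3.wiener_measurable W4.wiener_measurable)

  \<comment> \<open>\<open>K\<close> and \<open>d\<close> are chosen separately for each outcome;
    what follows uses them along a fixed path.\<close>
  have decomp: "AE \<omega> in P. (\<forall>i. continuous_on {0..T} (\<lambda>t. load_row p i \<bullet> w t \<omega>)) \<and>
      (\<forall>i. \<exists>K d. K-lipschitz_on {0..T} d \<and> (\<forall>t\<in>{0..T}. X t \<omega> $ i = load_row p i \<bullet> w t \<omega> + d t))"
  proof -
    have cont: "AE \<omega> in P. continuous_on {0..} (\<lambda>t. W1 t \<omega>)" "AE \<omega> in P. continuous_on {0..} (\<lambda>t. W2 t \<omega>)"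
      "AE \<omega> in P. continuous_on {0..} (\<lambda>t. W3 t \<omega>)" "AE \<omega> in P. continuous_on {0..} (\<lambda>t. W4 t \<omega>)"
      using wiener by (simp_all add: wiener_process_def)
    note drifts = sde_solution_drift_lipschitz[OF sde(1) drift(1), of T] sde_solution_drift_lipschitz[OF sde(2) drift(2), of T]
      sde_solution_drift_lipschitz[OF sde(3) drift(3), of T] sde_solution_drift_lipschitz[OF sde(4) drift(4), of T]
    show ?thesis
      using cont drifts AE_space
    proof eventually_elim
      case (elim \<omega>)
      have "continuous_on {0..T} (\<lambda>t. W1 t \<omega>)" "continuous_on {0..T} (\<lambda>t. W2 t \<omega>)"
        "continuous_on {0..T} (\<lambda>t. W3 t \<omega>)" "continuous_on {0..T} (\<lambda>t. W4 t \<omega>)"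
        using elim(1-4) by (auto elim!: continuous_on_subset)
      then have "\<forall>i. continuous_on {0..T} (\<lambda>t. load_row p i \<bullet> w t \<omega>)"
        unfolding load_row_def w_def inner_block_vec by (intro allI continuous_intros)
      moreover have "\<exists>K d. K-lipschitz_on {0..T} d \<and> (\<forall>t\<in>{0..T}. X t \<omega> $ i = load_row p i \<bullet> w t \<omega> + d t)" for i
      proof -
        obtain K1 D1 where 1: "K1-lipschitz_on {0..T} D1" "\<And>t. t \<in> {0..T} \<Longrightarrow> \<xi> t \<omega> = D1 t + S1 p *v W1 t \<omega>"
          using elim(5) by blast
        obtain K2 D2 where 2: "K2-lipschitz_on {0..T} D2" "\<And>t. t \<in> {0..T} \<Longrightarrow> \<delta> t \<omega> = D2 t + S2 p *v W2 t \<omega>"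
          using elim(6) by blast
        obtain K3 D3 where 3: "K3-lipschitz_on {0..T} D3" "\<And>t. t \<in> {0..T} \<Longrightarrow> \<epsilon> t \<omega> = D3 t + S3 p *v W3 t \<omega>"
          using elim(7) by blast
        obtain K4 D4 where 4: "K4-lipschitz_on {0..T} D4" "\<And>t. t \<in> {0..T} \<Longrightarrow> \<zeta> t \<omega> = D4 t + S4 p *v W4 t \<omega>"
          using elim(8) by blast
        obtain L1 where L1: "L1-lipschitz_on {0..T} (\<lambda>t. (R1 *v D1 t) $ i)"
          by (rule lipschitz_on_matrix_component[OF 1(1)])
        obtain L2 where L2: "L2-lipschitz_on {0..T} (\<lambda>t. (R2 *v D2 t) $ i)"
          by (rule lipschitz_on_matrix_component[OF 2(1)])
        obtain L3 where L3: "L3-lipschitz_on {0..T} (\<lambda>t. (R3 *v D3 t) $ i)"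
          by (rule lipschitz_on_matrix_component[OF 3(1)])
        obtain L4 where L4: "L4-lipschitz_on {0..T} (\<lambda>t. (R4 *v D4 t) $ i)"
          by (rule lipschitz_on_matrix_component[OF 4(1)])
        let ?d = "\<lambda>t. (R1 *v D1 t) $ i + (R2 *v D2 t) $ i + (R3 *v D3 t) $ i + (R4 *v D4 t) $ i"
        have "(L1 + L2 + L3 + L4)-lipschitz_on {0..T} ?d"
          by (intro lipschitz_on_add L1 L2 L3 L4)
        moreover have "X t \<omega> $ i = load_row p i \<bullet> w t \<omega> + ?d t" if t: "t \<in> {0..T}" for t
        proof -
          have "X t \<omega> = (R1 *v D1 t + R2 *v D2 t + R3 *v D3 t + R4 *v D4 t) +
              (load1 p *v W1 t \<omega> + load2 p *v W2 t \<omega> + load3 p *v W3 t \<omega> + load4 p *v W4 t \<omega>)"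
            using X[of t \<omega>] t elim(9)
            by (simp add: 1(2) 2(2) 3(2) 4(2) matrix_vector_right_distrib matrix_vector_mul_assoc load)
          then show ?thesis
            by (simp add: load_row_def w_def inner_block_vec matrix_vector_mult_component_inner)
        qed
        ultimately show ?thesis by blast
      qed
      ultimately show ?case by blast
    qed
  qed

  have "null_in_prob P (\<lambda>n \<omega>. realized_covar T (\<lambda>t \<omega>. X t \<omega> $ a) (\<lambda>t \<omega>. X t \<omega> $ b) n \<omega> -
      realized_covar T (\<lambda>t \<omega>. load_row p a \<bullet> w t \<omega>) (\<lambda>t \<omega>. load_row p b \<bullet> w t \<omega>) n \<omega>)"
  proof (rule null_in_prob_AE)
    show "AE \<omega> in P. (\<lambda>n. realized_covar T (\<lambda>t \<omega>. X t \<omega> $ a) (\<lambda>t \<omega>. X t \<omega> $ b) n \<omega> -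
      realized_covar T (\<lambda>t \<omega>. load_row p a \<bullet> w t \<omega>) (\<lambda>t \<omega>. load_row p b \<bullet> w t \<omega>) n \<omega>) \<longlonglongrightarrow> 0"
      using decomp
    proof eventually_elim
      case (elim \<omega>)
      obtain Ka da where a: "Ka-lipschitz_on {0..T} da" "\<And>t. t \<in> {0..T} \<Longrightarrow> X t \<omega> $ a = load_row p a \<bullet> w t \<omega> + da t"
        using elim by blast
      obtain Kb db where b: "Kb-lipschitz_on {0..T} db" "\<And>t. t \<in> {0..T} \<Longrightarrow> X t \<omega> $ b = load_row p b \<bullet> w t \<omega> + db t"
        using elim by blast
      show ?case
        by (rule realized_covar_lipschitz_perturbation[OF T _ _ a(1) b(1)]) (use elim a(2) b(2) in auto)
    qed
  qed (intro borel_measurable_diff realized_covar_measurable[OF T] X_meas w_meas)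
  \<comment> \<open>In the sum the covariation of the joint noise cancels; the factor
    \<open>1 / T\<close> passes to the normalisation of \<open>realized_cov\<close>.\<close>
  from null_in_prob_cmult[OF null_in_prob_add[OF this lim_w], of "1 / T"]
  have "null_in_prob P (\<lambda>n \<omega>. realized_covar T (\<lambda>t \<omega>. X t \<omega> $ a) (\<lambda>t \<omega>. X t \<omega> $ b) n \<omega> / T - Sigma_mat p $ a $ b)"
    using T by (simp add: diff_divide_distrib)
  \<comment> \<open>\<open>sample_vec\<close> is restricted to \<open>{0..n}\<close>, which contains
    both \<open>i\<close> and \<open>i - 1\<close> for every \<open>i\<close> in
    \<open>{1..n}\<close>.\<close>
  moreover have "realized_cov T n (sample_vec T X n \<omega>) $ a $ b =
      realized_covar T (\<lambda>t \<omega>. X t \<omega> $ a) (\<lambda>t \<omega>. X t \<omega> $ b) n \<omega> / T" for n \<omega>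
    unfolding realized_cov_def realized_covar_def vec_lambda_beta
    by (intro arg_cong2[where f = "(/)"] sum.cong refl) (auto simp: sample_vec_def grid_def)
  ultimately show ?thesis by simp
qed

lemma quasi_lik_pos:
  assumes "det S > 0" "T > 0" "n \<ge> 1"
  shows "quasi_lik T n S x > 0"
  unfolding quasi_lik_def Let_def using assms
  by (intro prod_pos mult_pos_pos divide_pos_pos) auto


theorem theorem2:
  fixes P :: "'a measure" and F :: "real \<Rightarrow> 'a measure"
    and W1 :: "real \<Rightarrow> 'a \<Rightarrow> real^'r1::finite"
    and W2 :: "real \<Rightarrow> 'a \<Rightarrow> real^'r2::finite"
    and W3 :: "real \<Rightarrow> 'a \<Rightarrow> real^'r3::finite"
    and W4 :: "real \<Rightarrow> 'a \<Rightarrow> real^'r4::finite"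
    and B1 :: "real^'k1::finite \<Rightarrow> real^'k1" and c1 :: "real^'k1"
    and B2 :: "real^'p1::finite \<Rightarrow> real^'p1" and c2 :: "real^'p1"
    and B3 :: "real^'p2::finite \<Rightarrow> real^'p2" and c3 :: "real^'p2"
    and B4 :: "real^'k2::finite \<Rightarrow> real^'k2" and c4 :: "real^'k2"
    and true_par :: "('p1, 'p2, 'k1, 'k2, 'r1, 'r2, 'r3, 'r4) sem_params"
    and \<xi> :: "real \<Rightarrow> 'a \<Rightarrow> real^'k1" and \<delta> :: "real \<Rightarrow> 'a \<Rightarrow> real^'p1"
    and \<epsilon> :: "real \<Rightarrow> 'a \<Rightarrow> real^'p2" and \<zeta> \<eta> :: "real \<Rightarrow> 'a \<Rightarrow> real^'k2"
    and X :: "real \<Rightarrow> 'a \<Rightarrow> real^('p1 + 'p2)"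
    and T :: real and M :: nat
    and J :: "nat \<Rightarrow> 'q::finite set" and q :: "nat \<Rightarrow> nat"
    and \<Theta> :: "nat \<Rightarrow> (real^'q) set"
    and par :: "nat \<Rightarrow> real^'q \<Rightarrow> ('p1, 'p2, 'k1, 'k2, 'r1, 'r2, 'r3, 'r4) sem_params"
    and \<Sigma> :: "nat \<Rightarrow> real^'q \<Rightarrow> real^('p1 + 'p2)^('p1 + 'p2)"
    and \<Sigma>0 :: "real^('p1 + 'p2)^('p1 + 'p2)"
    and \<theta>hat :: "nat \<Rightarrow> nat \<Rightarrow> (nat \<Rightarrow> real^('p1 + 'p2)) \<Rightarrow> real^'q"
    and mhat :: "nat \<Rightarrow> (nat \<Rightarrow> real^('p1 + 'p2)) \<Rightarrow> nat"
    and \<theta>bar :: "nat \<Rightarrow> real^'q"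
    and Mcor Mmis :: "nat set"
  assumes dims: "CARD('k1) \<le> CARD('p1)" "CARD('k2) \<le> CARD('p2)"
    and basis: "usual_stochastic_basis P F"
    and wiener: "wiener_process P F W1" "wiener_process P F W2"
      "wiener_process P F W3" "wiener_process P F W4"
    and wiener_indep: "prob_space.indep_sets P
      (\<lambda>j. [history P W1, history P W2, history P W3, history P W4] ! j) {0..<4}"
    and true_admissible: "admissible true_par"
    and sde: "sde_solution P F B1 (S1 true_par) W1 c1 \<xi>"
      "sde_solution P F B2 (S2 true_par) W2 c2 \<delta>"
      "sde_solution P F B3 (S3 true_par) W3 c3 \<epsilon>"
      "sde_solution P F B4 (S4 true_par) W4 c4 \<zeta>"
    and eta: "\<And>t \<omega>. t \<ge> 0 \<Longrightarrow> \<omega> \<in> space P \<Longrightarrow>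
      \<eta> t \<omega> = Bmat true_par *v \<eta> t \<omega> + Gam true_par *v \<xi> t \<omega> + \<zeta> t \<omega>"
    and obs: "\<And>t \<omega>. t \<ge> 0 \<Longrightarrow> \<omega> \<in> space P \<Longrightarrow>
      X t \<omega> = block_vec (Lam1 true_par *v \<xi> t \<omega> + \<delta> t \<omega>) (Lam2 true_par *v \<eta> t \<omega> + \<epsilon> t \<omega>)"
    and Sigma0: "\<Sigma>0 = Sigma_mat true_par"
    and T_pos: "T > 0"
    and q_dim: "\<And>m. m \<in> {1..M} \<Longrightarrow> q m = card (J m)"
    and Theta_sub: "\<And>m. m \<in> {1..M} \<Longrightarrow> \<Theta> m \<subseteq> coord_space (J m)"
    and Theta_convex: "\<And>m. m \<in> {1..M} \<Longrightarrow> convex (\<Theta> m)"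
    and Theta_compact: "\<And>m. m \<in> {1..M} \<Longrightarrow> compact (\<Theta> m)"
    and Theta_boundary: "\<And>m. m \<in> {1..M} \<Longrightarrow>
      locally_lipschitz_boundary (coord_space (J m)) (\<Theta> m)"
    and par_admissible: "\<And>m \<theta>. m \<in> {1..M} \<Longrightarrow> \<theta> \<in> \<Theta> m \<Longrightarrow> admissible (par m \<theta>)"
    and Sigma: "\<And>m \<theta>. m \<in> {1..M} \<Longrightarrow> \<theta> \<in> \<Theta> m \<Longrightarrow> \<Sigma> m \<theta> = Sigma_mat (par m \<theta>)"
    and Sigma_cont: "\<And>m. m \<in> {1..M} \<Longrightarrow> continuous_on (\<Theta> m) (\<Sigma> m)"
    and Mcor: "Mcor = {m \<in> {1..M}. \<exists>\<theta>0 \<in> \<Theta> m. \<Sigma>0 = \<Sigma> m \<theta>0}"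
    and Mmis: "Mmis = {1..M} - Mcor"
    and thetahat_measurable: "\<And>m n. m \<in> {1..M} \<Longrightarrow> n \<ge> 1 \<Longrightarrow>
      \<theta>hat m n \<in> borel_measurable (PiM {0..n} (\<lambda>_. borel))"
    and thetahat_max: "\<And>m n \<omega>. m \<in> {1..M} \<Longrightarrow> n \<ge> 1 \<Longrightarrow> \<omega> \<in> space P \<Longrightarrow>
      is_arg_max (\<lambda>\<theta>. quasi_lik T n (\<Sigma> m \<theta>) (sample_vec T X n \<omega>)) (\<lambda>\<theta>. \<theta> \<in> \<Theta> m)
        (\<theta>hat m n (sample_vec T X n \<omega>))"
    and mhat_measurable: "\<And>n. n \<ge> 1 \<Longrightarrow>
      mhat n \<in> measurable (PiM {0..n} (\<lambda>_. borel)) (count_space UNIV)"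
    and mhat_min: "\<And>n \<omega>. n \<ge> 1 \<Longrightarrow> \<omega> \<in> space P \<Longrightarrow>
      is_arg_min
        (\<lambda>m. QAIC T n (\<Sigma> m (\<theta>hat m n (sample_vec T X n \<omega>))) (q m) (sample_vec T X n \<omega>))
        (\<lambda>m. m \<in> {1..M}) (mhat n (sample_vec T X n \<omega>))"
    and thetabar: "\<And>m. m \<in> {1..M} \<Longrightarrow> \<theta>bar m \<in> \<Theta> m \<and>
      H_fun \<Sigma>0 (\<Sigma> m (\<theta>bar m)) = (SUP \<theta>\<in>\<Theta> m. H_fun \<Sigma>0 (\<Sigma> m \<theta>))"
    and drift_lipschitz: "\<exists>C>0. C-lipschitz_on UNIV B1" "\<exists>C>0. C-lipschitz_on UNIV B2"
      "\<exists>C>0. C-lipschitz_on UNIV B3" "\<exists>C>0. C-lipschitz_on UNIV B4"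
    and drift_smooth: "C_poly 4 B1" "C_poly 4 B2" "C_poly 4 B3" "C_poly 4 B4"
    and moments: "bounded_moments P \<xi>" "bounded_moments P \<delta>"
      "bounded_moments P \<epsilon>" "bounded_moments P \<zeta>"
    and identifiable: "\<And>m \<theta>. m \<in> {1..M} \<Longrightarrow> \<theta> \<in> \<Theta> m \<Longrightarrow>
      H_fun \<Sigma>0 (\<Sigma> m \<theta>) = H_fun \<Sigma>0 (\<Sigma> m (\<theta>bar m)) \<Longrightarrow> \<theta> = \<theta>bar m"
    and some_correct: "Mcor \<noteq> {}" and some_misspecified: "Mmis \<noteq> {}"
  shows "(\<lambda>n. measure P {\<omega> \<in> space P. mhat n (sample_vec T X n \<omega>) \<in> Mmis}) \<longlonglongrightarrow> 0"
proof -
  interpret prob_space P using basis by (simp add: usual_stochastic_basis_def)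
  define V where "V n \<omega> = realized_cov T n (sample_vec T X n \<omega>)" for n \<omega>
  have pd0: "pos_def_mat \<Sigma>0"
    using pos_def_mat_Sigma_mat[OF true_admissible] by (simp add: Sigma0)
  have pd: "pos_def_mat (\<Sigma> m \<theta>)" if "m \<in> {1..M}" "\<theta> \<in> \<Theta> m" for m \<theta>
    using pos_def_mat_Sigma_mat[OF par_admissible[OF that]] Sigma[OF that] by simp
  \<comment> \<open>All covariance matrices that the misspecified models offer. Pooling them gives
    one gap \<open>g\<close> and one radius \<open>d\<close> for all these models.\<close>
  define K where "K = (\<Union>m\<in>Mmis. \<Sigma> m ` \<Theta> m)"
  have "compact K"
    unfolding K_def using Mmis
    by (intro compact_UN compact_continuous_image Sigma_cont Theta_compact) auto
  moreover have "\<And>S. S \<in> K \<Longrightarrow> pos_def_mat S" and "\<Sigma>0 \<notin> K"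
    using Mmis Mcor pd by (auto simp: K_def)
  ultimately obtain g d where g: "g > 0" and d: "d > 0"
    and gap: "\<And>V S. S \<in> K \<Longrightarrow> (\<And>i j. \<bar>V $ i $ j - \<Sigma>0 $ i $ j\<bar> \<le> d) \<Longrightarrow> H_fun V S + g \<le> H_fun V \<Sigma>0"
    using pd0 H_fun_uniform_gap by metis
  obtain m0 \<theta>0 where m0: "m0 \<in> {1..M}" and \<theta>0: "\<theta>0 \<in> \<Theta> m0" "\<Sigma>0 = \<Sigma> m0 \<theta>0"
    using some_correct Mcor by auto
  \<comment> \<open>The penalty is the same on both sides, and the maximised quasi-likelihood of
    \<open>m0\<close> is at least its value at \<open>\<theta>0\<close>. Positivity of the latter is
    what makes the logarithm monotone here.\<close>
  have QAIC_correct: "QAIC T n (\<Sigma> m0 (\<theta>hat m0 n x)) (q m0) x \<le> QAIC T n \<Sigma>0 (q m0) x"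
    if n: "n \<ge> 1" and \<omega>: "\<omega> \<in> space P" and x: "x = sample_vec T X n \<omega>" for n \<omega> x
  proof -
    have "quasi_lik T n \<Sigma>0 x \<le> quasi_lik T n (\<Sigma> m0 (\<theta>hat m0 n x)) x"
      using thetahat_max[OF m0 n \<omega>] \<theta>0 by (simp add: is_arg_max_linorder x)
    moreover have "quasi_lik T n \<Sigma>0 x > 0"
      by (rule quasi_lik_pos[OF pos_def_mat_det_pos[OF pd0] T_pos n])
    ultimately have "ln (quasi_lik T n \<Sigma>0 x) \<le> ln (quasi_lik T n (\<Sigma> m0 (\<theta>hat m0 n x)) x)"
      by simp
    then show ?thesis by (simp add: QAIC_def)
  qed
  \<comment> \<open>Near \<Sigma>0 the fit of a misspecified model costs at least
    \<open>2 * n * g\<close>, whereas its advantage in the penalty is at most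
    \<open>2 * q m0\<close>; hence the threshold on \<open>n\<close>.\<close>
  have far: "\<exists>i j. d \<le> \<bar>V n \<omega> $ i $ j - \<Sigma>0 $ i $ j\<bar>"
    if n: "n \<ge> 1" "real (q m0) < g * real n" and \<omega>: "\<omega> \<in> space P"
      and mis: "mhat n (sample_vec T X n \<omega>) \<in> Mmis" for n \<omega>
  proof (rule ccontr)
    assume "\<not> ?thesis"
    then have near: "\<bar>V n \<omega> $ i $ j - \<Sigma>0 $ i $ j\<bar> \<le> d" for i j
      by (meson linear)
    define x where "x = sample_vec T X n \<omega>"
    define m where "m = mhat n x"
    define S where "S = \<Sigma> m (\<theta>hat m n x)"
    have m: "m \<in> Mmis" "m \<in> {1..M}" using mis Mmis by (auto simp: m_def x_def)
    have th: "\<theta>hat m n x \<in> \<Theta> m"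
      using thetahat_max[OF m(2) n(1) \<omega>] by (simp add: is_arg_max_def x_def)
    have "S \<in> K" using m(1) th by (auto simp: K_def S_def)
    from gap[OF this near] have gapS: "H_fun (V n \<omega>) S + g \<le> H_fun (V n \<omega>) \<Sigma>0" .
    have "QAIC T n S (q m) x \<le> QAIC T n (\<Sigma> m0 (\<theta>hat m0 n x)) (q m0) x"
      using mhat_min[OF n(1) \<omega>] m0 by (simp add: is_arg_min_linorder x_def m_def S_def)
    also have "\<dots> \<le> QAIC T n \<Sigma>0 (q m0) x"
      by (rule QAIC_correct[OF n(1) \<omega> x_def])
    finally have le: "QAIC T n S (q m) x \<le> QAIC T n \<Sigma>0 (q m0) x" .
    have "det S > 0" using pos_def_mat_det_pos[OF pd[OF m(2) th]] by (simp add: S_def)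
    from le[unfolded QAIC_eq_H_fun[OF this T_pos n(1)]
        QAIC_eq_H_fun[OF pos_def_mat_det_pos[OF pd0] T_pos n(1)]]
    have "real n * (H_fun (V n \<omega>) \<Sigma>0 - H_fun (V n \<omega>) S) + real (q m) \<le> real (q m0)"
      by (simp add: V_def x_def algebra_simps)
    moreover have "real n * g \<le> real n * (H_fun (V n \<omega>) \<Sigma>0 - H_fun (V n \<omega>) S)"
      using gapS by (intro mult_left_mono) auto
    ultimately show False using n(2) by (simp add: mult.commute)
  qed
  have null: "null_in_prob P (\<lambda>n \<omega>. V n \<omega> $ i $ j - \<Sigma>0 $ i $ j)" for i j
    unfolding V_def Sigma0
  proof (rule realized_cov_null_in_prob[OF basis wiener wiener_indep _ sde _ _ _ _ eta obs T_pos])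
    show "invertible (Psi true_par)" using true_admissible by (simp add: admissible_def)
    show "continuous_on UNIV B1" "continuous_on UNIV B2" "continuous_on UNIV B3" "continuous_on UNIV B4"
      using drift_lipschitz by (auto intro: lipschitz_on_continuous_on)
  qed
  \<comment> \<open>Indexing by pairs turns the two existential quantifiers of \<open>far\<close>
    into one finite union.\<close>
  define E where "E n ij = {\<omega> \<in> space P. d \<le> \<bar>V n \<omega> $ fst ij $ snd ij - \<Sigma>0 $ fst ij $ snd ij\<bar>}" for n ij
  have E_lim: "(\<lambda>n. prob (E n ij)) \<longlonglongrightarrow> 0" and E_meas: "E n ij \<in> events" for n ij
  proof -
    have 1: "(\<lambda>\<omega>. V n \<omega> $ fst ij $ snd ij - \<Sigma>0 $ fst ij $ snd ij) \<in> borel_measurable P" for n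
      using null by (simp add: null_in_prob_def)
    show "E n ij \<in> events"
      unfolding E_def using borel_measurable_abs[OF 1] by (intro borel_measurable_le borel_measurable_const)
    show "(\<lambda>n. prob (E n ij)) \<longlonglongrightarrow> 0"
      using null d by (simp add: null_in_prob_def E_def)
  qed
  show ?thesis
  proof (rule tendsto_sandwich[OF _ _ tendsto_const])
    \<comment> \<open>Beyond \<open>N\<close> the threshold of \<open>far\<close> is met; starting
      from \<open>Suc N\<close> also ensures \<open>n \<ge> 1\<close>.\<close>
    obtain N where N: "real (q m0) / g < real N" using reals_Archimedean2 by blast
    have "prob {\<omega> \<in> space P. mhat n (sample_vec T X n \<omega>) \<in> Mmis} \<le> (\<Sum>ij\<in>UNIV. prob (E n ij))"
      if n: "Suc N \<le> n" for n
    proof -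
      have "real (q m0) / g < real n" using N n by linarith
      then have "real (q m0) < g * real n" using g by (simp add: divide_less_eq mult.commute)
      then have "{\<omega> \<in> space P. mhat n (sample_vec T X n \<omega>) \<in> Mmis} \<subseteq> (\<Union>ij\<in>UNIV. E n ij)"
        using far[of n] n by (fastforce simp: E_def)
      then have "prob {\<omega> \<in> space P. mhat n (sample_vec T X n \<omega>) \<in> Mmis} \<le> prob (\<Union>ij\<in>UNIV. E n ij)"
        using E_meas by (intro finite_measure_mono) auto
      also have "\<dots> \<le> (\<Sum>ij\<in>UNIV. prob (E n ij))"
        using E_meas by (intro measure_UNION_le) auto
      finally show ?thesis .
    qed
    then show "\<forall>\<^sub>F n in sequentially. prob {\<omega> \<in> space P. mhat n (sample_vec T X n \<omega>) \<in> Mmis} \<le> (\<Sum>ij\<in>UNIV. prob (E n ij))"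
      using eventually_ge_at_top[of "Suc N"] by (rule eventually_mono[rotated])
    show "(\<lambda>n. \<Sum>ij\<in>UNIV. prob (E n ij)) \<longlonglongrightarrow> 0"
      by (intro tendsto_null_sum E_lim)
  qed simp
qed

end
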